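(* Let $\mathcal F_{\mathfrak w}$ be a Bernoulli flow with weights $w_1<w_2$ such that $\alpha=w_2/w_1$ is irrational, and let $D$ be its dimension. (1) If $\alpha$ has bounded coefficients in its continued fraction, then $$\psi_{\mathfrak w}(x)=\frac{x^D}{D}+O\left(x^D\left(\frac{\log\log x}{\log x}\right)^{1/4}\right)\quad\text{as }x\to\infty.$$ (2) If $\alpha$ is polynomially approximable, i.e. the coefficients $a_k$ of its continued fraction satisfy $a_{k+1}\le a(q_k)$ for every $k\ge0$, for some increasing function $a:(0,\infty)\to[1,\infty)$ with $a(x)=O(x^l)$ as $x\to\infty$, then $$\psi_{\mathfrak w}(x)=\frac{x^D}{D}+O\left(x^D\left(\frac{\log\log x}{\log x}\right)^{\frac1{4l+4}}\right)\quad\text{as }x\to\infty.$$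
   Context: Bernoulli flow (self-similar flow with $N=2$): $\Omega=\{1,2\}^{\mathbb N}$ with left shift $\sigma$, and a weight function $\mathfrak w:\Omega\to(0,\infty)$ depending only on the first letter: $\mathfrak w(a)=w_{a_1}$. The dimension $D>0$ of the flow is the unique real solution of $e^{-w_1s}+e^{-w_2s}=1$. For a periodic orbit $\mathfrak p$ of $\sigma$ (a finite set $\{a,\sigma a,\dots\}\subset\Omega$), put $\mathfrak w_t(\mathfrak p)=\sum_{a\in\mathfrak p}\mathfrak w(a)$. The counting function is $$\psi_{\mathfrak w}(x)=\sum_{k\mathfrak w_t(\mathfrak p)\le\log x}\mathfrak w_t(\mathfrak p),$$ the sum over all pairs of a periodic orbit $\mathfrak p$ and an integer $k\ge1$ with $k\mathfrak w_t(\mathfrak p)\le\log x$. The continued fraction is $\alpha=[[a_0,a_1,a_2,\dots]]=a_0+1/(a_1+1/(a_2+\cdots))$, and $q_k$ is the denominator of its $k$-th convergent $p_k/q_k=[[a_0,\dots,a_k]]$ (so $q_{-1}=0$, $q_0=1$, $q_{k+1}=a_{k+1}q_k+q_{k-1}$). *)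

theory Defs
  imports Complex_Main "HOL-Library.Landau_Symbols" "HOL-Library.Stream"
begin

section \<open>Bernoulli flows\<close>

text \<open>
  \<open>\<Omega> = {1,2}\<^sup>\<nat>\<close> is modelled by streams, the left shift \<open>\<sigma>\<close> being \<^const>\<open>stl\<close>. The first
  letter \<open>a\<^sub>1\<close> of \<open>a\<close> is \<^term>\<open>shd a\<close>.
\<close>

definition Omega :: "nat stream set" where
  "Omega = streams {1, 2}"

text \<open>
  Points that are merely eventually periodic also have a finite forward orbit; such orbits are
  not periodic orbits, hence the explicit return condition.
\<close>

definition periodic_orbits :: "nat stream set set" where
  "periodic_orbits =
     {{(stl ^^ n) a | n. True} | a. a \<in> Omega \<and> (\<exists>m\<ge>1. (stl ^^ m) a = a)}"

definition total_weight :: "(nat stream \<Rightarrow> real) \<Rightarrow> nat stream set \<Rightarrow> real" where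
  "total_weight \<ww> \<pp> = (\<Sum>a\<in>\<pp>. \<ww> a)"

text \<open>
  If \<open>\<ww>\<close> is bounded below by a positive constant on \<^const>\<open>Omega\<close>, as it is for a Bernoulli flow,
  the sum below is finite: an orbit of length \<open>n\<close> has total weight at least \<open>n\<close> times that constant.
\<close>

definition psi :: "(nat stream \<Rightarrow> real) \<Rightarrow> real \<Rightarrow> real" where
  "psi \<ww> x =
     (\<Sum>(\<pp>, k) \<in> {(\<pp>, k). \<pp> \<in> periodic_orbits \<and> (1::nat) \<le> k \<and>
                          real k * total_weight \<ww> \<pp> \<le> ln x}.
        total_weight \<ww> \<pp>)"

definition bernoulli_weight :: "(nat \<Rightarrow> real) \<Rightarrow> nat stream \<Rightarrow> real" where
  "bernoulli_weight w a = w (shd a)"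

definition bernoulli_dim :: "(nat \<Rightarrow> real) \<Rightarrow> real" where
  "bernoulli_dim w = (THE s. exp (- w 1 * s) + exp (- w 2 * s) = 1)"


section \<open>Continued fractions of irrational numbers\<close>

text \<open>
  The complete quotients \<open>\<alpha>\<^sub>0 = \<alpha>\<close>, \<open>\<alpha>\<^sub>k\<^sub>+\<^sub>1 = 1 / (\<alpha>\<^sub>k - \<lfloor>\<alpha>\<^sub>k\<rfloor>)\<close>. For irrational \<open>\<alpha>\<close> the process never
  stops (no division by zero occurs).
\<close>

primrec cf_quot :: "real \<Rightarrow> nat \<Rightarrow> real" where
  "cf_quot \<alpha> 0 = \<alpha>"
| "cf_quot \<alpha> (Suc k) = 1 / (cf_quot \<alpha> k - of_int \<lfloor>cf_quot \<alpha> k\<rfloor>)"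

definition cf_coeff :: "real \<Rightarrow> nat \<Rightarrow> int" where
  "cf_coeff \<alpha> k = \<lfloor>cf_quot \<alpha> k\<rfloor>"

text \<open>
  The denominators \<open>q\<^sub>k\<close> of the convergents; the second equation is the general recurrence at
  \<open>k = 0\<close> with \<open>q\<^sub>-\<^sub>1 = 0\<close>.
\<close>

fun cf_denom :: "real \<Rightarrow> nat \<Rightarrow> int" where
  "cf_denom \<alpha> 0 = 1"
| "cf_denom \<alpha> (Suc 0) = cf_coeff \<alpha> 1"
| "cf_denom \<alpha> (Suc (Suc k)) = cf_coeff \<alpha> (Suc (Suc k)) * cf_denom \<alpha> (Suc k) + cf_denom \<alpha> k"

definition cf_bounded :: "real \<Rightarrow> bool" where
  "cf_bounded \<alpha> \<longleftrightarrow> (\<exists>M. \<forall>k. \<bar>cf_coeff \<alpha> k\<bar> \<le> M)"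

text \<open>
  Only the values of \<open>a\<close> on \<open>(0,\<infinity>)\<close> matter. \<open>Increasing\<close> is read in the weak sense; this makes no
  difference, since adding the bounded function \<open>x \<mapsto> 1 - 1 / (1 + x)\<close> makes \<open>a\<close> strictly increasing.
\<close>

definition polynomially_approximable :: "real \<Rightarrow> real \<Rightarrow> bool" where
  "polynomially_approximable l \<alpha> \<longleftrightarrow>
     (\<exists>a :: real \<Rightarrow> real.
        mono_on {0<..} a \<and> (\<forall>x>0. 1 \<le> a x) \<and> a \<in> O(\<lambda>x. x powr l) \<and>
        (\<forall>k. of_int (cf_coeff \<alpha> (Suc k)) \<le> a (of_int (cf_denom \<alpha> k))))"

end

theory Submission
  imports Defs "HOL-Analysis.Analysis"
begin

text \<open>
  A pair of a periodic orbit \<open>p\<close> and a multiplicity \<open>k\<close>, together with a point of \<open>p\<close>, is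
  the same thing as a nonempty finite word over \<open>{1, 2}\<close>: repeat the word periodically.
  Therefore \<open>psi\<close> sums the weight of the first letter over all nonempty words of weight at most
  \<open>t = ln x\<close>, and splitting off the first letter gives
  \<open>psi x = w\<^sub>1 * N (t - w\<^sub>1) + w\<^sub>2 * N (t - w\<^sub>2)\<close>, where \<open>N t\<close> counts the words of weight
  at most \<open>t\<close> (lemma \<open>psi_eq_leaf_count\<close>). The monotone function \<open>M = N + 1\<close> satisfies
  \<open>M t = M (t - w\<^sub>1) + M (t - w\<^sub>2)\<close> for \<open>t \<ge> 0\<close>, with \<open>M = 1\<close> on the negative axis. The
  theorem is thus a renewal theorem with a rate for this equation.

  Put \<open>p\<^sub>i = exp (- D * w\<^sub>i)\<close> and \<open>g t = exp (- D * t) * M t\<close>. As \<open>p\<^sub>1 + p\<^sub>2 = 1\<close>, the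
  function \<open>g\<close> is the average of its values at \<open>t - w\<^sub>1\<close> and \<open>t - w\<^sub>2\<close>; it is bounded, and
  iterating \<open>n\<close> times makes \<open>g t\<close> an average with binomial weights. A binomial distribution
  differs from its translate by \<open>O(1 / sqrt n)\<close>, so that shifting the argument by \<open>w\<^sub>1\<close> or
  \<open>w\<^sub>2\<close> changes \<open>g\<close> only by \<open>O(1 / sqrt t)\<close> (lemma \<open>g_step\<close>), and shifting it by
  \<open>i * w\<^sub>1 + j * w\<^sub>2\<close> with integers of absolute value \<open>O(q)\<close> changes it by \<open>O(q / sqrt t)\<close>.

  If \<open>q\<close> is the denominator of a convergent of \<open>w\<^sub>2 / w\<^sub>1\<close>, such combinations come
  \<open>O(1 / q)\<close>-close to every point of \<open>[0, w\<^sub>2]\<close> (lemma \<open>lattice_covering\<close>). As \<open>M\<close> is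
  monotone, it follows that \<open>g\<close> varies by \<open>O(1 / q + q / sqrt t)\<close> on \<open>[t - w\<^sub>2, t]\<close> (lemma
  \<open>g_flat\<close>). The last denominator \<open>q\<close> below \<open>t powr (1 / 4)\<close> is at least of order
  \<open>t powr (1 / (4 * l + 4))\<close> by the assumption on the continued fraction, which yields the
  exponent; bounded coefficients are the case \<open>l = 0\<close>.

  Finally \<open>p\<^sub>1 * integral {t - w\<^sub>1..t} g + p\<^sub>2 * integral {t - w\<^sub>2..t} g\<close> does not
  depend on \<open>t\<close> and equals \<open>1 / D\<close> (lemma \<open>renewal_invariant\<close>). Since \<open>g\<close> is nearly
  constant on these windows,
  \<open>exp (- D * t) * psi x = p\<^sub>1 * w\<^sub>1 * g (t - w\<^sub>1) + p\<^sub>2 * w\<^sub>2 * g (t - w\<^sub>2) + o(1)\<close> is close to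
  \<open>1 / D\<close>, with the same rate.
\<close>

section \<open>Periodic orbits and words\<close>

definition orbit :: "nat stream \<Rightarrow> nat stream set" where
  "orbit a = range (\<lambda>n. sdrop n a)"

lemma funpow_stl: "(stl ^^ n) a = sdrop n a"
  by (induction n arbitrary: a) (simp_all add: funpow_Suc_right del: funpow.simps(2))

lemma periodic_orbits_eq: "periodic_orbits = {orbit a | a. a \<in> Omega \<and> (\<exists>m\<ge>1. sdrop m a = a)}"
  unfolding periodic_orbits_def orbit_def funpow_stl full_SetCompr_eq by (auto simp: full_SetCompr_eq)

lemma sdrop_mult:
  assumes "sdrop d a = a"
  shows "sdrop (k * d) a = a"
  by (induction k) (simp_all add: assms flip: sdrop_add)

lemma sdrop_mod:
  assumes "sdrop d a = a"
  shows "sdrop (n mod d) a = sdrop n a"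
proof -
  have "sdrop n a = sdrop (n div d * d + n mod d) a" by simp
  also have "\<dots> = sdrop (n mod d) (sdrop (n div d * d) a)" by (simp only: sdrop_add)
  finally show ?thesis by (simp add: sdrop_mult[OF assms])
qed

text \<open>
  The cardinality of a periodic orbit is the least period of each of its points: a smaller number of
  shifts already repeats a point, and the least period divides every period.
\<close>
lemma periodic_orbit_structure:
  assumes "p \<in> periodic_orbits" "a \<in> p"
  shows "a \<in> Omega" "p = orbit a" "finite p" "1 \<le> card p" "sdrop (card p) a = a"
    "bij_betw (\<lambda>n. sdrop n a) {..<card p} p" "\<And>n. sdrop n a = a \<longleftrightarrow> card p dvd n"
proof -
  obtain b m where b: "p = orbit b" "b \<in> Omega" "m \<ge> 1" "sdrop m b = b"
    using assms by (auto simp: periodic_orbits_eq)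
  obtain i where i: "a = sdrop i b" using assms b by (auto simp: orbit_def)
  show "a \<in> Omega" using b(2) unfolding i Omega_def by (simp add: streams_iff_snth sdrop_snth)
  have ma: "sdrop m a = a" unfolding i by (metis add.commute b(4) sdrop_add)
  have "b = sdrop (i * m) b" using sdrop_mult[OF b(4)] by simp
  also have "\<dots> = sdrop (i * m - i) a" unfolding i using b(3) by simp
  finally have ba: "b = sdrop (i * m - i) a" .
  show p: "p = orbit a"
    unfolding b(1) orbit_def
  proof (intro equalityI subsetI)
    fix x assume "x \<in> range (\<lambda>n. sdrop n b)"
    then obtain n where "x = sdrop n b" by auto
    then have "x = sdrop (i * m - i + n) a" using ba by (simp flip: sdrop_add)
    then show "x \<in> range (\<lambda>n. sdrop n a)" by blast
  next
    fix x assume "x \<in> range (\<lambda>n. sdrop n a)"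
    then obtain n where "x = sdrop n a" by auto
    then have "x = sdrop (i + n) b" using i by (simp flip: sdrop_add)
    then show "x \<in> range (\<lambda>n. sdrop n b)" by blast
  qed
  define d where "d = (LEAST n. n \<ge> 1 \<and> sdrop n a = a)"
  have d: "d \<ge> 1" "sdrop d a = a"
    using LeastI[of "\<lambda>n. n \<ge> 1 \<and> sdrop n a = a" m] b(3) ma by (auto simp: d_def)
  have least: "d \<le> n" if "n \<ge> 1" "sdrop n a = a" for n
    unfolding d_def by (rule Least_le) (use that in auto)
  have dvd: "sdrop n a = a \<longleftrightarrow> d dvd n" for n
  proof
    assume "sdrop n a = a"
    then have "sdrop (n mod d) a = a" using sdrop_mod[OF d(2)] by simp
    then show "d dvd n" using least[of "n mod d"] d(1) mod_less_divisor[of d n] by (metis One_nat_def Suc_leI dvd_eq_mod_eq_0 gr0I leD less_le_trans zero_less_one)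
  next
    assume "d dvd n"
    then show "sdrop n a = a" using sdrop_mult[OF d(2)] by (metis dvd_div_mult_self)
  qed
  have inj: "inj_on (\<lambda>n. sdrop n a) {..<d}"
  proof (rule linorder_inj_onI)
    fix x y assume xy: "x < y" "x \<in> {..<d}" "y \<in> {..<d}"
    show "sdrop x a \<noteq> sdrop y a"
    proof
      assume "sdrop x a = sdrop y a"
      then have "sdrop (x + (d - y)) a = sdrop (y + (d - y)) a" by (simp flip: sdrop_add)
      also have "\<dots> = a" using xy d by simp
      finally have "d dvd x + (d - y)" by (simp add: dvd)
      then show False using xy by (auto dest!: dvd_imp_le)
    qed
  qed auto
  have im: "(\<lambda>n. sdrop n a) ` {..<d} = p"
  proof -
    have "sdrop n a \<in> (\<lambda>n. sdrop n a) ` {..<d}" for n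
      using sdrop_mod[OF d(2), of n, symmetric] d(1) by auto
    then show ?thesis by (auto simp: p orbit_def)
  qed
  have card: "card p = d" using card_image[OF inj] im by simp
  show "finite p" using im by (metis finite_imageI finite_lessThan)
  show "1 \<le> card p" "sdrop (card p) a = a" using card d by auto
  show "bij_betw (\<lambda>n. sdrop n a) {..<card p} p" using inj im card by (simp add: bij_betw_def)
  show "\<And>n. sdrop n a = a \<longleftrightarrow> card p dvd n" using dvd card by simp
qed

lemma orbit_cycle_periodic:
  assumes "u \<in> lists {1, 2}" "u \<noteq> []"
  shows "orbit (cycle u) \<in> periodic_orbits" "cycle u \<in> orbit (cycle u)"
proof -
  have "cycle u \<in> Omega"
    using assms sset_cycle[of u] by (auto simp: Omega_def streams_iff_sset)
  moreover have "\<exists>m\<ge>1. sdrop m (cycle u) = cycle u"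
    using assms by (intro exI[of _ "length u"]) (auto simp: Suc_le_eq)
  ultimately show "orbit (cycle u) \<in> periodic_orbits" by (auto simp: periodic_orbits_eq)
  show "cycle u \<in> orbit (cycle u)" unfolding orbit_def by (rule range_eqI[of _ _ 0]) simp
qed

lemma periodic_eq_cycle_stake:
  assumes "sdrop n a = a" "0 < n"
  shows "a = cycle (stake n a)"
proof -
  define c where "c = cycle (stake n a)"
  have "stake n a \<noteq> []" using assms(2) by (cases n) auto
  then have "stake n c = stake n a" "sdrop n c = c"
    using stake_cycle_eq[of "stake n a"] sdrop_cycle_eq[of "stake n a"] by (simp_all add: c_def)
  have snth: "x !! i = stake n x ! (i mod n)" if "sdrop n x = x" for x :: "'a stream" and i
    using sdrop_mod[OF that, of i] assms(2) sdrop_snth[of i x 0] sdrop_snth[of "i mod n" x 0] by simp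
  have "snth a = snth c"
    using snth[OF assms(1)] snth[OF \<open>sdrop n c = c\<close>] \<open>stake n c = stake n a\<close> by auto
  then show ?thesis unfolding c_def[symmetric] by (metis stream_smap_nats)
qed

definition word_weight :: "(nat \<Rightarrow> real) \<Rightarrow> nat list \<Rightarrow> real" where
  "word_weight w u = sum_list (map w u)"

lemma word_weight_stake: "word_weight w (stake n a) = (\<Sum>i<n. w (shd (sdrop i a)))"
  by (simp add: word_weight_def sum_list_sum_nth atLeast0LessThan)

lemma word_weight_repeated_period:
  assumes "p \<in> periodic_orbits" "a \<in> p"
  shows "word_weight w (stake (k * card p) a) = real k * total_weight (bernoulli_weight w) p"
proof (induction k)
  case (Suc k)
  note * = periodic_orbit_structure[OF assms]
  have "stake (Suc k * card p) a = stake (k * card p) a @ stake (card p) (sdrop (k * card p) a)"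
    by (simp add: stake_add add.commute)
  then have "word_weight w (stake (Suc k * card p) a)
    = word_weight w (stake (k * card p) a) + word_weight w (stake (card p) (sdrop (k * card p) a))"
    by (simp only: word_weight_def map_append sum_list_append)
  also have "sdrop (k * card p) a = a" by (rule sdrop_mult[OF *(5)])
  also have "word_weight w (stake (card p) a) = total_weight (bernoulli_weight w) p"
    unfolding word_weight_stake total_weight_def bernoulli_weight_def
    by (rule sum.reindex_bij_betw[OF *(6)])
  finally show ?case using Suc by (simp add: algebra_simps)
qed (simp add: word_weight_def)

text \<open>
  Words are lists over the alphabet \<open>{1, 2}\<close>; the empty word is included.
\<close>
definition words_upto :: "(nat \<Rightarrow> real) \<Rightarrow> real \<Rightarrow> nat list set" where
  "words_upto w t = {u \<in> lists {1, 2}. word_weight w u \<le> t}"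

lemma Cons_in_words_upto:
  "x # u \<in> words_upto w t \<longleftrightarrow> x \<in> {1,2} \<and> u \<in> words_upto w (t - w x)"
  by (auto simp: words_upto_def word_weight_def)

lemma finite_words_upto:
  assumes "0 < w 1" "0 < w 2"
  shows "finite (words_upto w t)"
proof -
  define c where "c = min (w 1) (w 2)"
  have "0 < c" using assms by (simp add: c_def)
  have ge: "real (length u) * c \<le> word_weight w u" if "u \<in> lists {1,2}" for u
    using that by induction (auto simp: word_weight_def c_def algebra_simps)
  obtain n where n: "t < real n * c" using reals_Archimedean3[OF \<open>0 < c\<close>] by blast
  have "length u \<le> n" if "u \<in> words_upto w t" for u
  proof -
    have "real (length u) * c < real n * c" using that ge[of u] n by (auto simp: words_upto_def)
    then show ?thesis using \<open>0 < c\<close> by simp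
  qed
  then have "words_upto w t \<subseteq> {u. set u \<subseteq> {1,2} \<and> length u \<le> n}"
    by (auto simp: words_upto_def in_lists_conv_set)
  then show ?thesis using finite_lists_length_le[of "{1,2::nat}" n] finite_subset by blast
qed

lemma words_upto_decomp:
  "words_upto w t - {[]} = (#) 1 ` words_upto w (t - w 1) \<union> (#) 2 ` words_upto w (t - w 2)"
  (is "?L = ?R")
proof (intro set_eqI)
  fix u show "u \<in> ?L \<longleftrightarrow> u \<in> ?R" by (cases u) (auto simp: Cons_in_words_upto)
qed

lemma sum_nonempty_words:
  fixes f :: "nat \<Rightarrow> real"
  assumes "0 < w 1" "0 < w 2"
  shows "(\<Sum>u\<in>words_upto w t - {[]}. f (hd u)) =
    f 1 * card (words_upto w (t - w 1)) + f 2 * card (words_upto w (t - w 2))"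
proof -
  have "(\<Sum>u\<in>words_upto w t - {[]}. f (hd u)) =
    (\<Sum>u\<in>(#) 1 ` words_upto w (t - w 1). f (hd u)) + (\<Sum>u\<in>(#) 2 ` words_upto w (t - w 2). f (hd u))"
    unfolding words_upto_decomp using finite_words_upto[OF assms] by (intro sum.union_disjoint) auto
  then show ?thesis by (simp add: sum.reindex)
qed

text \<open>
  The words of weight at most \<open>t\<close> are the inner nodes of a finite binary tree, in which the
  children of a word are its two extensions by a letter; this is the number of its leaves. For
  negative \<open>t\<close> the tree is a single leaf.
\<close>
definition leaf_count :: "(nat \<Rightarrow> real) \<Rightarrow> real \<Rightarrow> real" where
  "leaf_count w t = 1 + real (card (words_upto w t))"

lemma words_upto_neg:
  assumes "0 < w 1" "0 < w 2" "t < 0"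
  shows "words_upto w t = {}"
proof -
  have "0 \<le> word_weight w u" if "u \<in> lists {1,2}" for u
    using that assms by induction (auto simp: word_weight_def)
  then show ?thesis using assms by (fastforce simp: words_upto_def)
qed

lemma leaf_count_rec:
  assumes "0 < w 1" "0 < w 2" "0 \<le> t"
  shows "leaf_count w t = leaf_count w (t - w 1) + leaf_count w (t - w 2)"
proof -
  have "[] \<in> words_upto w t" using assms by (simp add: words_upto_def word_weight_def)
  then have "card (words_upto w t) = 1 + card (words_upto w t - {[]})"
    using finite_words_upto[of w t] assms card.remove[of "words_upto w t" "[]"] by simp
  moreover have "real (card (words_upto w t - {[]})) = card (words_upto w (t - w 1)) + card (words_upto w (t - w 2))"
    using sum_nonempty_words[of w "\<lambda>_. 1" t] assms by simp
  ultimately show ?thesis by (simp add: leaf_count_def)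
qed

lemma leaf_count_mono:
  assumes "0 < w 1" "0 < w 2"
  shows "mono (leaf_count w)"
proof (rule monoI)
  fix s t :: real assume "s \<le> t"
  then have "words_upto w s \<subseteq> words_upto w t" by (auto simp: words_upto_def)
  then show "leaf_count w s \<le> leaf_count w t"
    using card_mono finite_words_upto[of w t] assms by (simp add: leaf_count_def)
qed

text \<open>
  A point \<open>a\<close> of an orbit \<open>p\<close>, together with a multiplicity \<open>k\<close>, determines the word
  formed by the first \<open>k * card p\<close> letters of \<open>a\<close>, and the word determines \<open>a\<close> by periodic
  repetition, hence \<open>p\<close> and \<open>k\<close>. The weight of the word is \<open>k\<close> times that of the orbit, so
  the conditions on both sides agree. Spreading the weight of \<open>p\<close> over its points, \<open>a\<close>
  contributes the weight of its first letter.
\<close>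
lemma psi_eq_sum_words:
  assumes "0 < w 1" "0 < w 2"
  shows "psi (bernoulli_weight w) x = (\<Sum>u\<in>words_upto w (ln x) - {[]}. w (hd u))"
proof -
  define S where "S = {(\<pp>, k). \<pp> \<in> periodic_orbits \<and> (1::nat) \<le> k \<and>
      real k * total_weight (bernoulli_weight w) \<pp> \<le> ln x}"
  define F where "F = (\<lambda>((\<pp> :: nat stream set, k), a). stake (k * card \<pp>) (a :: nat stream))"
  let ?T = "SIGMA z:S. fst z"
  have F: "F ((p, k), a) \<in> words_upto w (ln x) - {[]}" "cycle (F ((p, k), a)) = a"
      "length (F ((p, k), a)) = k * card p" "hd (F ((p, k), a)) = shd a"
    if "(p, k) \<in> S" "a \<in> p" for p k a
  proof -
    have p: "p \<in> periodic_orbits" "1 \<le> k" "real k * total_weight (bernoulli_weight w) p \<le> ln x"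
      using that by (auto simp: S_def)
    note * = periodic_orbit_structure[OF p(1) that(2)]
    have pos: "0 < k * card p" using p(2) *(4) by simp
    show "cycle (F ((p, k), a)) = a"
      using periodic_eq_cycle_stake[OF sdrop_mult[OF *(5)] pos] by (simp add: F_def)
    show "length (F ((p, k), a)) = k * card p" by (simp add: F_def)
    obtain m where m: "k * card p = Suc m" using pos by (metis gr0_implies_Suc)
    show "hd (F ((p, k), a)) = shd a" by (simp add: F_def m)
    have "stake (k * card p) a \<in> lists {1,2}"
      using *(1) stake_sdrop[of "k * card p" a] by (metis Omega_def in_listsI streams_iff_sset Un_iff sset_shift subset_iff)
    then show "F ((p, k), a) \<in> words_upto w (ln x) - {[]}"
      using p(3) word_weight_repeated_period[OF p(1) that(2), of w k] pos
      by (simp add: F_def words_upto_def m)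
  qed
  have inj: "inj_on F ?T"
  proof (rule inj_onI)
    fix y z assume yz: "y \<in> ?T" "z \<in> ?T" "F y = F z"
    obtain p k a p' k' a' where e: "y = ((p, k), a)" "z = ((p', k'), a')" by (metis surj_pair)
    have mem: "(p, k) \<in> S" "a \<in> p" "(p', k') \<in> S" "a' \<in> p'" using yz e by auto
    have "a = a'" using F(2)[OF mem(1,2)] F(2)[OF mem(3,4)] yz e by simp
    moreover have "p = p'"
      using periodic_orbit_structure(2)[of p a] periodic_orbit_structure(2)[of p' a'] mem \<open>a = a'\<close>
      by (auto simp: S_def)
    moreover have "k = k'"
      using F(3)[OF mem(1,2)] F(3)[OF mem(3,4)] yz e \<open>p = p'\<close> periodic_orbit_structure(4)[of p a] mem
      by (auto simp: S_def)
    ultimately show "y = z" using e by simp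
  qed
  have "words_upto w (ln x) - {[]} \<subseteq> F ` ?T"
  proof
    fix u assume u: "u \<in> words_upto w (ln x) - {[]}"
    define p where "p = orbit (cycle u)"
    have p: "p \<in> periodic_orbits" "cycle u \<in> p"
      using u orbit_cycle_periodic[of u] by (auto simp: p_def words_upto_def)
    have "sdrop (length u) (cycle u) = cycle u" using u by simp
    then have "card p dvd length u" using periodic_orbit_structure(7)[OF p] by simp
    then obtain k where k: "length u = k * card p" by (metis dvd_div_mult_self)
    have Fu: "F ((p, k), cycle u) = u" using u by (simp add: F_def flip: k)
    have "1 \<le> k" using u k by (cases k) auto
    moreover have "real k * total_weight (bernoulli_weight w) p \<le> ln x"
      using word_weight_repeated_period[OF p, of w k] u Fu by (simp add: F_def words_upto_def)
    ultimately have "((p, k), cycle u) \<in> ?T" using p by (simp add: S_def)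
    then show "u \<in> F ` ?T" using Fu by (metis image_eqI)
  qed
  then have im: "F ` ?T = words_upto w (ln x) - {[]}" using F(1) by auto
  have fin: "finite ?T"
    using finite_words_upto[of w "ln x"] assms im inj by (metis finite_Diff finite_imageD)
  have "S \<subseteq> fst ` ?T"
  proof
    fix z assume z: "z \<in> S"
    obtain p k where e: "z = (p, k)" by fastforce
    then obtain b where "p = orbit b" using z by (auto simp: S_def periodic_orbits_eq)
    then have "b \<in> p" by (auto simp: orbit_def intro: range_eqI[of _ _ 0])
    then show "z \<in> fst ` ?T" using z e by force
  qed
  then have "finite S" using fin finite_subset by blast
  have finp: "\<forall>z\<in>S. finite (fst z)"
  proof
    fix z assume z: "z \<in> S"
    then have "fst z \<in> periodic_orbits" by (auto simp: S_def)
    then show "finite (fst z)"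
      using periodic_orbit_structure(3)[of "fst z"] by (cases "fst z = {}") auto
  qed
  have "psi (bernoulli_weight w) x = (\<Sum>z\<in>S. \<Sum>a\<in>fst z. w (shd a))"
    unfolding psi_def S_def[symmetric]
    by (simp add: case_prod_beta total_weight_def bernoulli_weight_def)
  also have "\<dots> = (\<Sum>y\<in>?T. w (shd (snd y)))"
    by (subst sum.Sigma[OF \<open>finite S\<close> finp]) (simp add: case_prod_beta)
  also have "\<dots> = (\<Sum>y\<in>?T. w (hd (F y)))"
    using F(4) by (intro sum.cong) auto
  also have "\<dots> = (\<Sum>u\<in>F ` ?T. w (hd u))"
    using inj by (simp add: sum.reindex)
  finally show ?thesis by (simp only: im)
qed

lemma psi_eq_leaf_count:
  assumes "0 < w 1" "0 < w 2"
  shows "psi (bernoulli_weight w) x =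
    w 1 * leaf_count w (ln x - w 1) + w 2 * leaf_count w (ln x - w 2) - (w 1 + w 2)"
  using psi_eq_sum_words[OF assms] sum_nonempty_words[OF assms, of w]
  by (simp add: leaf_count_def algebra_simps)


section \<open>Convergents of continued fractions\<close>

lemma cf_quot_irrational: "\<alpha> \<notin> \<rat> \<Longrightarrow> cf_quot \<alpha> k \<notin> \<rat>"
proof (induction k)
  case (Suc k)
  show ?case
  proof
    assume "cf_quot \<alpha> (Suc k) \<in> \<rat>"
    then have "inverse (cf_quot \<alpha> (Suc k)) + of_int \<lfloor>cf_quot \<alpha> k\<rfloor> \<in> \<rat>"
      by (intro Rats_add Rats_inverse Rats_of_int)
    then show False using Suc by simp
  qed
qed simp

lemma cf_quot_frac:
  assumes "\<alpha> \<notin> \<rat>"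
  shows "0 < cf_quot \<alpha> k - cf_coeff \<alpha> k" "cf_quot \<alpha> k - cf_coeff \<alpha> k < 1"
proof -
  have "cf_quot \<alpha> k \<noteq> of_int \<lfloor>cf_quot \<alpha> k\<rfloor>"
    using cf_quot_irrational[OF assms, of k] by (metis Rats_of_int)
  then show "0 < cf_quot \<alpha> k - cf_coeff \<alpha> k" "cf_quot \<alpha> k - cf_coeff \<alpha> k < 1"
    unfolding cf_coeff_def by linarith+
qed

lemma cf_quot_Suc_gt_1: "\<alpha> \<notin> \<rat> \<Longrightarrow> 1 < cf_quot \<alpha> (Suc k)"
  using cf_quot_frac[of \<alpha> k] by (simp add: cf_coeff_def)

lemma cf_coeff_Suc_ge_1: "\<alpha> \<notin> \<rat> \<Longrightarrow> 1 \<le> cf_coeff \<alpha> (Suc k)"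
  using cf_quot_Suc_gt_1[of \<alpha> k] unfolding cf_coeff_def by linarith

fun cf_num :: "real \<Rightarrow> nat \<Rightarrow> int" where
  "cf_num \<alpha> 0 = cf_coeff \<alpha> 0"
| "cf_num \<alpha> (Suc 0) = cf_coeff \<alpha> 1 * cf_coeff \<alpha> 0 + 1"
| "cf_num \<alpha> (Suc (Suc k)) = cf_coeff \<alpha> (Suc (Suc k)) * cf_num \<alpha> (Suc k) + cf_num \<alpha> k"

lemma cf_denom_ge_1: "\<alpha> \<notin> \<rat> \<Longrightarrow> 1 \<le> cf_denom \<alpha> k"
proof (induction \<alpha> k rule: cf_denom.induct)
  case (2 \<alpha>)
  then show ?case using cf_coeff_Suc_ge_1[of \<alpha> 0] by simp
next
  case (3 \<alpha> k)
  have "0 \<le> cf_coeff \<alpha> (Suc (Suc k)) * cf_denom \<alpha> (Suc k)"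
    using cf_coeff_Suc_ge_1[OF "3.prems", of "Suc k"] 3 by simp
  then show ?case using 3 by simp
qed simp

lemma cf_denom_mono:
  assumes "\<alpha> \<notin> \<rat>"
  shows "cf_denom \<alpha> k \<le> cf_denom \<alpha> (Suc k)"
proof (cases k)
  case 0
  then show ?thesis using cf_coeff_Suc_ge_1[OF assms, of 0] by simp
next
  case (Suc m)
  have "1 * cf_denom \<alpha> (Suc m) \<le> cf_coeff \<alpha> (Suc (Suc m)) * cf_denom \<alpha> (Suc m)"
    using cf_coeff_Suc_ge_1[OF assms, of "Suc m"] cf_denom_ge_1[OF assms, of "Suc m"]
    by (intro mult_right_mono) auto
  then show ?thesis using Suc cf_denom_ge_1[OF assms, of m] by simp
qed

lemma cf_denom_Suc_le:
  assumes "\<alpha> \<notin> \<rat>"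
  shows "cf_denom \<alpha> (Suc k) \<le> (cf_coeff \<alpha> (Suc k) + 1) * cf_denom \<alpha> k"
proof (cases k)
  case (Suc m)
  then show ?thesis using cf_denom_mono[OF assms, of m] by (simp add: algebra_simps)
qed simp

lemma cf_denom_ge_index: "\<alpha> \<notin> \<rat> \<Longrightarrow> int k \<le> cf_denom \<alpha> k"
proof (induction \<alpha> k rule: cf_denom.induct)
  case (2 \<alpha>)
  then show ?case using cf_coeff_Suc_ge_1[of \<alpha> 0] by simp
next
  case (3 \<alpha> k)
  have "1 * cf_denom \<alpha> (Suc k) \<le> cf_coeff \<alpha> (Suc (Suc k)) * cf_denom \<alpha> (Suc k)"
    using cf_coeff_Suc_ge_1[OF "3.prems", of "Suc k"] cf_denom_ge_1[OF "3.prems", of "Suc k"]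
    by (intro mult_right_mono) auto
  then show ?case
    using "3.IH"(1)[OF "3.prems"] cf_denom_ge_1[OF "3.prems", of k]
    unfolding cf_denom.simps by linarith
qed simp

lemma cf_determinant:
  "cf_num \<alpha> (Suc k) * cf_denom \<alpha> k - cf_num \<alpha> k * cf_denom \<alpha> (Suc k) = (-1) ^ k"
proof (induction k)
  case (Suc k)
  have "cf_num \<alpha> (Suc (Suc k)) * cf_denom \<alpha> (Suc k) - cf_num \<alpha> (Suc k) * cf_denom \<alpha> (Suc (Suc k))
     = - (cf_num \<alpha> (Suc k) * cf_denom \<alpha> k - cf_num \<alpha> k * cf_denom \<alpha> (Suc k))"
    by (simp add: algebra_simps)
  then show ?case using Suc by simp
qed simp

lemma cf_coprime: "coprime (cf_num \<alpha> k) (cf_denom \<alpha> k)"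
proof (rule coprimeI)
  fix c assume "c dvd cf_num \<alpha> k" "c dvd cf_denom \<alpha> k"
  then have "c dvd cf_num \<alpha> (Suc k) * cf_denom \<alpha> k - cf_num \<alpha> k * cf_denom \<alpha> (Suc k)" by simp
  then have "c dvd (-1) ^ k" unfolding cf_determinant .
  then show "is_unit c" by (metis dvd_trans dvd_def is_unit_power_iff minus_one_mult_self power_minus1_even)
qed

text \<open>
  This is \<open>\<alpha> = (\<alpha>\<^sub>k\<^sub>+\<^sub>2 * p\<^sub>k\<^sub>+\<^sub>1 + p\<^sub>k) / (\<alpha>\<^sub>k\<^sub>+\<^sub>2 * q\<^sub>k\<^sub>+\<^sub>1 + q\<^sub>k)\<close> without the division: the recurrence
  of numerators and denominators applied to the complete quotient \<open>\<alpha>\<^sub>k\<^sub>+\<^sub>2\<close> itself instead of its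
  integral part is exact.
\<close>
lemma cf_quot_eq:
  assumes "\<alpha> \<notin> \<rat>"
  shows "\<alpha> * (cf_quot \<alpha> (Suc (Suc k)) * cf_denom \<alpha> (Suc k) + cf_denom \<alpha> k)
    = cf_quot \<alpha> (Suc (Suc k)) * cf_num \<alpha> (Suc k) + cf_num \<alpha> k"
proof (induction k)
  have step: "cf_quot \<alpha> (Suc k) * (cf_quot \<alpha> k - cf_coeff \<alpha> k) = 1" for k
    using cf_quot_frac[OF assms, of k] by (simp add: cf_coeff_def)
  {
    case 0
    define x y z where "x = cf_quot \<alpha> 1" and "y = cf_quot \<alpha> (Suc (Suc 0))" and "z = real_of_int (cf_coeff \<alpha> 1)"
    have 1: "x * (\<alpha> - cf_coeff \<alpha> 0) = 1" using step[of 0] by (simp add: x_def del: cf_quot.simps(2))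
    have 2: "y * (x - z) = 1" using step[of "Suc 0"] by (simp add: x_def y_def z_def del: cf_quot.simps(2))
    define b where "b = \<alpha> - cf_coeff \<alpha> 0"
    have "x * b = 1" using 1 by (simp add: b_def)
    have "y * z + 1 = y * x" using 2 by (simp add: algebra_simps)
    then have "b * (y * z + 1) = y * (x * b)" by (simp only: mult_ac)
    then have "b * (y * z + 1) = y" using \<open>x * b = 1\<close> by simp
    moreover have e: "real_of_int (cf_denom \<alpha> (Suc 0)) = z" "real_of_int (cf_denom \<alpha> 0) = 1"
      "real_of_int (cf_num \<alpha> (Suc 0)) = z * cf_coeff \<alpha> 0 + 1"
      "cf_num \<alpha> 0 = cf_coeff \<alpha> 0" by (simp_all add: z_def)
    ultimately show ?case unfolding y_def[symmetric] e by (simp add: b_def algebra_simps)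
  next
    case (Suc k)
    define x y z where "x = cf_quot \<alpha> (Suc (Suc k))" and "y = cf_quot \<alpha> (Suc (Suc (Suc k)))"
      and "z = real_of_int (cf_coeff \<alpha> (Suc (Suc k)))"
    define p0 p1 q0 q1 where "p0 = real_of_int (cf_num \<alpha> k)" and "p1 = real_of_int (cf_num \<alpha> (Suc k))"
      and "q0 = real_of_int (cf_denom \<alpha> k)" and "q1 = real_of_int (cf_denom \<alpha> (Suc k))"
    have 2: "y * (x - z) = 1"
      using step[of "Suc (Suc k)"] by (simp add: x_def y_def z_def del: cf_quot.simps(2))
    then have y: "y * x = y * z + 1" by (simp add: algebra_simps)
    have IH: "\<alpha> * (x * q1 + q0) = x * p1 + p0" using Suc by (simp only: x_def p0_def p1_def q0_def q1_def)
    have "\<alpha> * (y * (z * q1 + q0) + q1) = \<alpha> * ((y * z + 1) * q1 + y * q0)" by (simp add: algebra_simps)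
    also have "\<dots> = y * (\<alpha> * (x * q1 + q0))" unfolding y[symmetric] by (simp add: algebra_simps)
    also have "\<dots> = (y * x) * p1 + y * p0" unfolding IH by (simp add: algebra_simps)
    also have "\<dots> = y * (z * p1 + p0) + p1" unfolding y by (simp add: algebra_simps)
    finally show ?case
      by (simp add: x_def y_def z_def p0_def p1_def q0_def q1_def del: cf_quot.simps(2))
  }
qed

text \<open>
  Subtracting \<open>p\<^sub>k / q\<^sub>k\<close> from the exact formula for \<open>\<alpha>\<close> leaves the determinant
  \<open>\<plusminus>1\<close> in the numerator.
\<close>
lemma convergent_approximation:
  assumes "\<alpha> \<notin> \<rat>"
  shows "\<bar>\<alpha> - cf_num \<alpha> k / cf_denom \<alpha> k\<bar> \<le> 1 / (cf_denom \<alpha> k)\<^sup>2"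
proof (cases k)
  case 0
  then show ?thesis using cf_quot_frac[OF assms, of 0] by simp
next
  case (Suc m)
  define x where "x = cf_quot \<alpha> (Suc (Suc m))"
  define p0 p1 q0 q1 where "p0 = real_of_int (cf_num \<alpha> m)" and "p1 = real_of_int (cf_num \<alpha> (Suc m))"
    and "q0 = real_of_int (cf_denom \<alpha> m)" and "q1 = real_of_int (cf_denom \<alpha> (Suc m))"
  have q: "1 \<le> q0" "1 \<le> q1" using cf_denom_ge_1[OF assms] by (simp_all add: q0_def q1_def)
  have x: "1 < x" using cf_quot_Suc_gt_1[OF assms] by (simp only: x_def)
  have eq: "\<alpha> * (x * q1 + q0) = x * p1 + p0"
    using cf_quot_eq[OF assms, of m] by (simp only: x_def p0_def p1_def q0_def q1_def)
  have det: "p1 * q0 - p0 * q1 = (-1) ^ m"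
    using arg_cong[OF cf_determinant[of \<alpha> m], of real_of_int]
    by (simp add: p0_def p1_def q0_def q1_def)
  have "1 * q1 \<le> x * q1" using q x by (intro mult_right_mono) auto
  then have Q: "q1 \<le> x * q1 + q0" using q by linarith
  have "(\<alpha> - p1 / q1) * ((x * q1 + q0) * q1) = \<alpha> * (x * q1 + q0) * q1 - p1 * (x * q1 + q0)"
    using q by (simp add: field_simps)
  also have "\<dots> = - (p1 * q0 - p0 * q1)" unfolding eq by (simp add: algebra_simps)
  finally have "\<bar>(\<alpha> - p1 / q1) * ((x * q1 + q0) * q1)\<bar> = 1"
    by (simp only: det abs_minus_cancel power_abs abs_one power_one)
  moreover have "0 < (x * q1 + q0) * q1" using q Q by simp
  ultimately have "\<bar>\<alpha> - p1 / q1\<bar> * ((x * q1 + q0) * q1) = 1"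
    by (metis abs_mult abs_of_pos)
  moreover have "\<bar>\<alpha> - p1 / q1\<bar> * (q1 * q1) \<le> \<bar>\<alpha> - p1 / q1\<bar> * ((x * q1 + q0) * q1)"
    using q Q by (intro mult_left_mono mult_right_mono) auto
  ultimately have "\<bar>\<alpha> - p1 / q1\<bar> * (q1 * q1) \<le> 1" by simp
  then have "\<bar>\<alpha> - p1 / q1\<bar> \<le> 1 / q1\<^sup>2"
    using q by (simp add: pos_le_divide_eq power2_eq_square)
  then show ?thesis by (simp add: Suc p1_def q1_def)
qed

lemma polynomially_approximable_exponent_nonneg:
  assumes "polynomially_approximable l \<alpha>"
  shows "0 \<le> l"
proof (rule ccontr)
  assume "\<not> 0 \<le> l"
  obtain a where a: "\<forall>x>0. 1 \<le> a x" "a \<in> O(\<lambda>x. x powr l)"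
    using assms by (auto simp: polynomially_approximable_def)
  from a(2) obtain c where c: "eventually (\<lambda>x. norm (a x) \<le> c * norm (x powr l)) at_top"
    by (auto elim!: landau_o.bigE)
  have "((\<lambda>x. c * norm (x powr l)) \<longlongrightarrow> c * norm (0::real)) at_top"
    using \<open>\<not> 0 \<le> l\<close> by (intro tendsto_intros tendsto_neg_powr filterlim_ident) auto
  then have "eventually (\<lambda>x. c * norm (x powr l) < 1) at_top"
    by (auto dest!: order_tendstoD(2)[where a = 1])
  with c eventually_gt_at_top[of 0] have "eventually (\<lambda>x::real. False) at_top"
  proof eventually_elim
    case (elim x)
    then show False using a(1) by (smt (verit) real_norm_def)
  qed
  then show False by simp
qed

text \<open>
  Exponent \<open>0\<close> with a constant bound: this reduces the case of bounded coefficients to the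
  polynomial one.
\<close>
lemma cf_bounded_imp_polynomially_approximable:
  assumes "cf_bounded \<alpha>"
  shows "polynomially_approximable 0 \<alpha>"
proof -
  obtain C where C: "\<And>k. \<bar>cf_coeff \<alpha> k\<bar> \<le> C" using assms by (auto simp: cf_bounded_def)
  have "(\<lambda>_. real_of_int (max 1 C)) \<in> O(\<lambda>x::real. x powr 0)"
  proof (rule landau_o.bigI[of "real_of_int (max 1 C)"])
    show "\<forall>\<^sub>F x in at_top. norm (real_of_int (max 1 C)) \<le> real_of_int (max 1 C) * norm ((x::real) powr 0)"
      using eventually_gt_at_top[of 0] by eventually_elim auto
  qed simp
  moreover have "real_of_int (cf_coeff \<alpha> k) \<le> of_int (max 1 C)" for k
    using C[of k] by (simp add: of_int_le_iff del: of_int_max)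
  ultimately show ?thesis
    unfolding polynomially_approximable_def
    by (intro exI[of _ "\<lambda>_. of_int (max 1 C)"]) (auto simp: mono_on_def simp del: of_int_max)
qed

text \<open>
  The fraction is the last convergent whose denominator does not exceed \<open>K\<close>; the next
  denominator is larger than \<open>K\<close>, but at most \<open>(a\<^sub>k\<^sub>+\<^sub>1 + 1) * q\<^sub>k\<close>, and
  \<open>a\<^sub>k\<^sub>+\<^sub>1\<close> is polynomially bounded in \<open>q\<^sub>k\<close>.
\<close>
lemma good_denominator_below:
  assumes irr: "\<alpha> \<notin> \<rat>" and poly: "polynomially_approximable l \<alpha>"
  obtains C where "0 < C"
    "\<And>K::real. 1 \<le> K \<Longrightarrow> \<exists>p q::int. coprime p q \<and> 1 \<le> q \<and> real_of_int q \<le> K \<and>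
       \<bar>\<alpha> - p / q\<bar> \<le> 1 / (real_of_int q)\<^sup>2 \<and> K \<le> C * q powr (l + 1)"
proof -
  obtain a where a: "mono_on {0<..} a" "\<forall>x>0. 1 \<le> a x" "a \<in> O(\<lambda>x. x powr l)"
      "\<And>k. of_int (cf_coeff \<alpha> (Suc k)) \<le> a (of_int (cf_denom \<alpha> k))"
    using poly by (auto simp: polynomially_approximable_def)
  have l: "0 \<le> l" using polynomially_approximable_exponent_nonneg[OF poly] .
  from a(3) obtain c where "0 < c" and ev: "eventually (\<lambda>x. norm (a x) \<le> c * norm (x powr l)) at_top"
    by (auto elim!: landau_o.bigE)
  from ev obtain x0 where x0: "\<And>x. x0 \<le> x \<Longrightarrow> norm (a x) \<le> c * norm (x powr l)"
    by (auto simp: eventually_at_top_linorder)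
  \<comment> \<open>The asymptotic bound on \<open>a\<close> becomes a bound on \<open>[1, \<infinity>)\<close>: by monotonicity
    \<open>a x \<le> a (x1 * x)\<close>, and \<open>x1 * x\<close> lies beyond \<open>x0\<close>.\<close>
  define x1 where "x1 = max x0 1"
  define B where "B = c * x1 powr l"
  have B: "a x \<le> B * x powr l" if "1 \<le> x" for x
  proof -
    have le: "a x \<le> a (x1 * x)"
      using a(1) that mult_right_mono[of 1 x1 x] by (auto simp: mono_on_def x1_def)
    have "x0 \<le> x1 * x" using that mult_left_mono[of 1 x x1] by (auto simp: x1_def)
    then have "a (x1 * x) \<le> c * (x1 * x) powr l" using x0[of "x1 * x"] by simp
    also have "\<dots> = B * x powr l" using that by (simp add: B_def powr_mult x1_def)
    finally show ?thesis using le by simp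
  qed
  have "0 < B" using \<open>0 < c\<close> by (simp add: B_def x1_def)
  have "\<exists>p q::int. coprime p q \<and> 1 \<le> q \<and> real_of_int q \<le> K \<and>
       \<bar>\<alpha> - p / q\<bar> \<le> 1 / (real_of_int q)\<^sup>2 \<and> K \<le> (B + 1) * q powr (l + 1)" if "1 \<le> K" for K
  proof -
    define P where "P k \<longleftrightarrow> K < real_of_int (cf_denom \<alpha> k)" for k
    obtain n where "K < real n" using reals_Archimedean2 by blast
    moreover have "real n \<le> real_of_int (cf_denom \<alpha> n)"
      using cf_denom_ge_index[OF irr, of n] by linarith
    ultimately have "P n" by (simp add: P_def)
    moreover have "\<not> P 0" using that by (simp add: P_def)
    ultimately obtain k where k: "\<not> P k" "P (Suc k)"
      using ex_least_nat_less[of P n] by (metis order_refl)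
    define q where "q = cf_denom \<alpha> k"
    have q: "1 \<le> real_of_int q" using cf_denom_ge_1[OF irr, of k] by (simp add: q_def)
    have "K \<le> real_of_int ((cf_coeff \<alpha> (Suc k) + 1) * q)"
      using k cf_denom_Suc_le[OF irr, of k] unfolding P_def q_def by linarith
    also have "\<dots> = (real_of_int (cf_coeff \<alpha> (Suc k)) + 1) * q" by simp
    also have "\<dots> \<le> (B * q powr l + 1 * q powr l) * q"
    proof (intro mult_right_mono add_mono)
      show "real_of_int (cf_coeff \<alpha> (Suc k)) \<le> B * q powr l"
        using a(4)[of k] B[OF q] by (simp add: q_def)
      show "1 \<le> 1 * real_of_int q powr l" using q l by (simp add: ge_one_powr_ge_zero)
    qed (use q in simp)
    also have "\<dots> = (B + 1) * q powr (l + 1)" using q by (simp add: powr_add algebra_simps)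
    finally have "K \<le> (B + 1) * q powr (l + 1)" .
    then show ?thesis
      using k(1) q cf_coprime[of \<alpha> k] convergent_approximation[OF irr, of k]
      by (intro exI[of _ "cf_num \<alpha> k"] exI[of _ q]) (auto simp: P_def q_def)
  qed
  then show thesis using that[of "B + 1"] \<open>0 < B\<close> by auto
qed

text \<open>
  Every multiple of \<open>1 / q\<close> has the form \<open>i + j * p / q\<close> with \<open>0 \<le> j < q\<close>, because
  \<open>p\<close> is invertible modulo \<open>q\<close>. Replacing \<open>p / q\<close> by \<open>\<alpha>\<close> moves them by at most
  \<open>j / q\<^sup>2 < 1 / q\<close>.
\<close>
lemma lattice_covering:
  fixes p q :: int and \<alpha> s :: real
  assumes cop: "coprime p q" and q: "0 < q" and approx: "\<bar>\<alpha> - p / q\<bar> \<le> 1 / (real_of_int q)\<^sup>2"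
  obtains i j :: int where "0 \<le> j" "j < q" "s \<le> i + j * \<alpha>" "i + j * \<alpha> \<le> s + 3 / q"
proof -
  \<comment> \<open>\<open>N / q\<close> lies between \<open>s + 1 / q\<close> and \<open>s + 2 / q\<close>, which leaves room for an
    error of \<open>1 / q\<close> on both sides.\<close>
  define N where "N = \<lceil>s * q + 1\<rceil>"
  have q': "0 < real_of_int q" using q by simp
  have N: "s * q + 1 \<le> N" "N \<le> s * q + 2" unfolding N_def by linarith+
  obtain u v where uv: "u * p + v * q = 1"
    using cop bezout_int[of p q] by (auto simp: coprime_iff_gcd_eq_1)
  define j where "j = (N * u) mod q"
  define i where "i = N * v + ((N * u) div q) * p"
  have "N = N * u * p + N * v * q" using uv by (metis distrib_left mult.assoc mult.right_neutral)
  also have "N * u = (N * u) div q * q + j" by (simp add: j_def)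
  finally have ij: "N = i * q + j * p" by (simp add: i_def algebra_simps)
  have j: "0 \<le> j" "j < q" using q by (simp_all add: j_def)
  have "i + j * \<alpha> - N / q = j * (\<alpha> - p / q)"
    using q' by (simp add: ij field_simps)
  also have "\<bar>\<dots>\<bar> \<le> q * (1 / (real_of_int q)\<^sup>2)"
    unfolding abs_mult using j approx by (intro mult_mono) auto
  also have "\<dots> = 1 / q" using q' by (simp add: power2_eq_square)
  finally have *: "\<bar>i + j * \<alpha> - N / q\<bar> \<le> 1 / q" .
  have "(s * q + 1) / q \<le> N / q" "N / q \<le> (s * q + 2) / q"
    using N q' by (intro divide_right_mono; simp)+
  then have "s + 1 / q \<le> N / q" "N / q \<le> s + 2 / q"
    using q' by (simp_all add: add_divide_distrib)
  moreover have "3 / real_of_int q = 2 / q + 1 / q" by (simp add: add_divide_distrib[symmetric])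
  ultimately have "s \<le> i + j * \<alpha>" "i + j * \<alpha> \<le> s + 3 / q" using * by linarith+
  then show thesis using that j by blast
qed


section \<open>Translates of binomial distributions\<close>

text \<open>
  \<open>Bernstein n k x\<close> is the probability of \<open>k\<close> successes in \<open>n\<close> trials of success
  probability \<open>x\<close>. This lemma and the next one express an average over \<open>n\<close> trials, the
  second one shifted by one success, as averages over \<open>n + 1\<close> trials. Subtracting them compares a
  binomial distribution with its translate, and the difference of the two weights is proportional to
  \<open>(n + 1) * x - k\<close>, the deviation from the mean.
\<close>
lemma sum_Bernstein_forward:
  fixes h :: "nat \<Rightarrow> real"
  assumes "x \<noteq> 1"
  shows "(\<Sum>k\<le>n. Bernstein n k x * h k) =
    (\<Sum>k\<le>Suc n. Bernstein (Suc n) k x * ((real (Suc n) - real k) / ((1 - x) * real (Suc n))) * h k)"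
proof -
  have "Bernstein n k x = Bernstein (Suc n) k x * ((real (Suc n) - real k) / ((1 - x) * real (Suc n)))"
    if "k \<le> n" for k
  proof -
    have "real (Suc n) * real (n choose k) = (real (Suc n) - real k) * real (Suc n choose k)"
    proof -
      have "real ((Suc n - k) * (Suc n choose k)) = real (Suc n * (n choose k))"
        using binomial_absorb_comp[of "Suc n" k] by (simp only: diff_Suc_1)
      then show ?thesis
        using that by (simp only: of_nat_mult of_nat_diff le_SucI)
    qed
    then have e: "real (n choose k) = (real (Suc n) - real k) * real (Suc n choose k) / real (Suc n)"
      by (simp add: field_simps)
    have "(1 - x) ^ (Suc n - k) = (1 - x) * (1 - x) ^ (n - k)"
      using that by (simp add: Suc_diff_le)
    then show ?thesis
      using assms unfolding Bernstein_def e by (simp add: divide_simps del: binomial_Suc_Suc)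
  qed
  then show ?thesis by simp
qed

lemma sum_Bernstein_backward:
  fixes h :: "nat \<Rightarrow> real"
  assumes "x \<noteq> 0"
  shows "(\<Sum>k\<le>n. Bernstein n k x * h (Suc k)) =
    (\<Sum>k\<le>Suc n. Bernstein (Suc n) k x * (real k / (x * real (Suc n))) * h k)"
proof -
  have "Bernstein n k x = Bernstein (Suc n) (Suc k) x * (real (Suc k) / (x * real (Suc n)))" for k
  proof -
    have "real (Suc k) * real (Suc n choose Suc k) = real (Suc n) * real (n choose k)"
      using Suc_times_binomial_eq[of n k] by (metis mult.commute of_nat_mult)
    then have e: "real (n choose k) = real (Suc k) * real (Suc n choose Suc k) / real (Suc n)"
      by (simp add: field_simps)
    show ?thesis
      using assms unfolding Bernstein_def e by (simp add: divide_simps del: binomial_Suc_Suc)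
  qed
  then show ?thesis by (simp add: sum.atMost_Suc_shift del: sum.atMost_Suc)
qed

text \<open>
  The variance is \<open>n * x * (1 - x) = c\<^sup>2\<close>, and
  \<open>\<bar>y\<bar> \<le> (y\<^sup>2 / c + c) / 2\<close> by the inequality of the means, whose average is \<open>c\<close>.
\<close>
lemma Bernstein_mean_abs_deviation:
  assumes "0 < x" "x < 1" "0 < n"
  shows "(\<Sum>k\<le>n. Bernstein n k x * \<bar>real n * x - real k\<bar>) \<le> sqrt (real n * x * (1 - x))"
proof -
  define c where "c = sqrt (real n * x * (1 - x))"
  have c: "0 < c" "c\<^sup>2 = real n * x * (1 - x)"
    using assms by (auto simp: c_def)
  have "(\<Sum>k\<le>n. Bernstein n k x * (real n * x - real k)\<^sup>2) =
     (\<Sum>k\<le>n. (real n * x)\<^sup>2 * Bernstein n k x + (1 - 2 * (real n * x)) * (real k * Bernstein n k x)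
         + real k * (real k - 1) * Bernstein n k x)"
    by (intro sum.cong) (auto simp: power2_eq_square algebra_simps)
  also have "\<dots> = c\<^sup>2"
    unfolding sum.distrib c(2)
    by (simp flip: sum_distrib_left) (simp add: power2_eq_square algebra_simps)
  finally have var: "(\<Sum>k\<le>n. Bernstein n k x * (real n * x - real k)\<^sup>2) = c\<^sup>2" .
  have "\<bar>y\<bar> \<le> (y\<^sup>2 / c + c) / 2" for y :: real
  proof -
    have "0 \<le> (\<bar>y\<bar> - c)\<^sup>2" by simp
    then have "2 * \<bar>y\<bar> * c \<le> y\<^sup>2 + c\<^sup>2" by (simp add: power2_diff)
    then show ?thesis using c by (simp add: field_simps power2_eq_square)
  qed
  then have "(\<Sum>k\<le>n. Bernstein n k x * \<bar>real n * x - real k\<bar>) \<le>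
    (\<Sum>k\<le>n. Bernstein n k x * (((real n * x - real k)\<^sup>2 / c + c) / 2))"
    using assms by (intro sum_mono mult_left_mono Bernstein_nonneg) auto
  also have "\<dots> = (\<Sum>k\<le>n. Bernstein n k x * (real n * x - real k)\<^sup>2) / (2 * c)
      + (\<Sum>k\<le>n. Bernstein n k x) * c / 2"
    unfolding sum_divide_distrib sum_distrib_right sum.distrib[symmetric]
    by (intro sum.cong) (auto simp: field_simps)
  also have "\<dots> = c" unfolding var sum_Bernstein using c(1) by (simp add: power2_eq_square)
  finally show ?thesis by (simp add: c_def)
qed

section \<open>Two-term renewal equations: loss of memory\<close>

text \<open>
  The initial value \<open>1\<close> on the negative axis makes the equation homogeneous on all of
  \<open>[0, \<infinity>)\<close>. Counting words of weight at most \<open>t\<close> gives an additional \<open>1\<close> for the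
  empty word on the right-hand side; counting instead the leaves of the corresponding binary tree
  (one more than the number of inner nodes) removes it.
\<close>
locale two_term_renewal =
  fixes w1 w2 D :: real and M :: "real \<Rightarrow> real"
  assumes w1_pos: "0 < w1" and w1_less_w2: "w1 < w2"
    and D_pos: "0 < D" and char_eq: "exp (- (D * w1)) + exp (- (D * w2)) = 1"
    and M_mono: "mono M" and M_neg: "\<And>t. t < 0 \<Longrightarrow> M t = 1"
    and M_rec: "\<And>t. 0 \<le> t \<Longrightarrow> M t = M (t - w1) + M (t - w2)"
begin

text \<open>
  By the characteristic equation \<open>p1\<close> and \<open>p2\<close> are the probabilities of a random step, of
  length \<open>w1\<close> or \<open>w2\<close>. The function \<open>g\<close> is \<open>M\<close> without its exponential growth; on
  \<open>[0, \<infinity>)\<close> it is harmonic for the random walk that goes backwards by such steps.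
\<close>
definition "p1 = exp (- (D * w1))"
definition "p2 = exp (- (D * w2))"
definition "g t = exp (- (D * t)) * M t"

lemma p_pos: "0 < p1" "0 < p2" and p_sum: "p1 + p2 = 1"
  using char_eq by (auto simp: p1_def p2_def)

lemma p_less_1: "p1 < 1" "p2 < 1"
  using p_pos p_sum by auto

lemma w2_pos: "0 < w2"
  using w1_pos w1_less_w2 by simp

lemma M_ge_1: "1 \<le> M t"
  using monoD[OF M_mono, of "min t (-1)" t] M_neg[of "min t (-1)"] by simp

lemma g_pos: "0 < g t"
  using M_ge_1[of t] by (simp add: g_def)

lemma g_rec: "0 \<le> t \<Longrightarrow> g t = p1 * g (t - w1) + p2 * g (t - w2)"
  by (simp add: g_def p1_def p2_def M_rec algebra_simps flip: exp_add)

text \<open>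
  The function \<open>g\<close> is discontinuous, but \<open>M\<close> increases, so that \<open>g\<close> cannot drop faster
  than exponentially. This one-sided control is what allows the passage from arguments in a fine
  but discrete set to all arguments.
\<close>
lemma g_slow_decrease: "s \<le> t \<Longrightarrow> g s \<le> exp (D * (t - s)) * g t"
proof -
  assume "s \<le> t"
  then have "exp (- (D * s)) * M s \<le> exp (- (D * s)) * M t"
    by (intro mult_left_mono monoD[OF M_mono]) auto
  also have "\<dots> = exp (D * (t - s)) * g t"
    by (simp add: g_def algebra_simps flip: exp_add)
  finally show ?thesis by (simp add: g_def)
qed

definition "gmax = exp (D * w2)"

lemma gmax_ge_1: "1 \<le> gmax"
  using D_pos w2_pos by (simp add: gmax_def)

text \<open>
  On \<open>[-w2, 0)\<close> the bound is explicit, and averaging preserves it; the induction proceeds by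
  intervals of length \<open>w1\<close>, the shortest step.
\<close>
lemma g_le_gmax:
  assumes "- w2 \<le> t"
  shows "g t \<le> gmax"
proof -
  have neg: "g t \<le> gmax" if "- w2 \<le> t" "t < 0" for t
    using that D_pos mult_left_mono[of "- w2" t D] by (simp add: g_def M_neg gmax_def)
  have "\<forall>t. - w2 \<le> t \<longrightarrow> t < real n * w1 \<longrightarrow> g t \<le> gmax" for n
  proof (induction n)
    case 0
    then show ?case using neg by simp
  next
    case (Suc n)
    show ?case
    proof (intro allI impI)
      fix t assume t: "- w2 \<le> t" "t < real (Suc n) * w1"
      show "g t \<le> gmax"
      proof (cases "t < 0")
        case True
        then show ?thesis using t neg by simp
      next
        case False
        then have "g t = p1 * g (t - w1) + p2 * g (t - w2)" by (simp add: g_rec)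
        also have "\<dots> \<le> p1 * gmax + p2 * gmax"
          using False t w1_less_w2 Suc.IH p_pos
          by (intro add_mono mult_left_mono) (auto simp: algebra_simps)
        also have "\<dots> = gmax" using p_sum by (metis distrib_right mult_1)
        finally show ?thesis .
      qed
    qed
  qed
  moreover obtain n where "t < real n * w1"
    using reals_Archimedean3[OF w1_pos] by blast
  ultimately show ?thesis using assms by blast
qed

text \<open>
  The renewal equation iterated \<open>n\<close> times. Of \<open>n\<close> steps, the number \<open>k\<close> of those of length
  \<open>w2\<close> is binomially distributed, and they end at \<open>t - n * w1 - k * (w2 - w1)\<close>. The
  assumption on \<open>t\<close> keeps all intermediate arguments in the range of the equation.
\<close>
lemma g_binomial:
  assumes "real n * w2 \<le> t"
  shows "g t = (\<Sum>k\<le>n. Bernstein n k p2 * g (t - real n * w1 - real k * (w2 - w1)))"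
  using assms
proof (induction n arbitrary: t)
  case 0
  then show ?case by (simp add: Bernstein_def)
next
  case (Suc n)
  define h where "h k = g (t - real (Suc n) * w1 - real k * (w2 - w1))" for k
  have p: "p2 \<noteq> 0" "p2 \<noteq> 1" "1 - p2 = p1" using p_pos p_sum p_less_1 by auto
  have "0 \<le> real (Suc n) * w2" using w2_pos by simp
  then have "0 \<le> t" using Suc.prems by linarith
  then have t: "real n * w2 \<le> t - w1" "real n * w2 \<le> t - w2" "0 \<le> t"
    using Suc.prems w1_less_w2 w2_pos by (auto simp: algebra_simps)
  have "g (t - w1) = (\<Sum>k\<le>n. Bernstein n k p2 * h k)"
    unfolding Suc.IH[OF t(1)] by (intro sum.cong) (auto simp: h_def algebra_simps)
  moreover have "g (t - w2) = (\<Sum>k\<le>n. Bernstein n k p2 * h (Suc k))"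
    unfolding Suc.IH[OF t(2)] by (intro sum.cong) (auto simp: h_def algebra_simps)
  ultimately have "g t = p1 * (\<Sum>k\<le>n. Bernstein n k p2 * h k)
      + p2 * (\<Sum>k\<le>n. Bernstein n k p2 * h (Suc k))"
    using g_rec[OF t(3)] by simp
  also have "\<dots> = (\<Sum>k\<le>Suc n. p1 * (Bernstein (Suc n) k p2 *
        ((real (Suc n) - real k) / ((1 - p2) * real (Suc n))) * h k)
      + p2 * (Bernstein (Suc n) k p2 * (real k / (p2 * real (Suc n))) * h k))"
    unfolding sum_Bernstein_forward[OF p(2), of n h] sum_Bernstein_backward[OF p(1), of n h]
      sum_distrib_left sum.distrib ..
  also have "\<dots> = (\<Sum>k\<le>Suc n. Bernstein (Suc n) k p2 * h k)"
  proof (intro sum.cong refl)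
    fix k
    define b where "b = Bernstein (Suc n) k p2 * h k"
    have "p1 * (Bernstein (Suc n) k p2 * ((real (Suc n) - real k) / ((1 - p2) * real (Suc n))) * h k)
      + p2 * (Bernstein (Suc n) k p2 * (real k / (p2 * real (Suc n))) * h k)
      = b * (p1 * ((real (Suc n) - real k) / (p1 * real (Suc n))) + p2 * (real k / (p2 * real (Suc n))))"
      unfolding p(3) b_def by (simp only: algebra_simps)
    also have "p1 * ((real (Suc n) - real k) / (p1 * real (Suc n))) + p2 * (real k / (p2 * real (Suc n))) = 1"
      using p_pos by (simp add: divide_simps)
    finally show "p1 * (Bernstein (Suc n) k p2 * ((real (Suc n) - real k) / ((1 - p2) * real (Suc n))) * h k)
      + p2 * (Bernstein (Suc n) k p2 * (real k / (p2 * real (Suc n))) * h k)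
      = Bernstein (Suc n) k p2 * h k" by (simp add: b_def)
  qed
  finally show ?case by (simp add: h_def)
qed

text \<open>
  Both values are averages of the same function \<open>h\<close>, the second with respect to the translated
  binomial distribution. The two distributions overlap up to the mean absolute deviation divided by
  the variance, which is of order \<open>1 / sqrt n\<close>: the random walk forgets its first step.
\<close>
lemma g_shift_diff_binomial:
  assumes "real n * w2 \<le> t - w2"
  shows "\<bar>g (t - w1) - g (t - w2)\<bar> \<le> gmax / sqrt (p1 * p2 * real (Suc n))"
proof -
  define N where "N = Suc n"
  define h where "h k = g (t - real (Suc n) * w1 - real k * (w2 - w1))" for k
  have p: "p2 \<noteq> 0" "p2 \<noteq> 1" "1 - p2 = p1" "0 < p1" "0 < p2" using p_pos p_sum p_less_1 by auto
  have N: "0 < real N" by (simp add: N_def)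
  have "g (t - w1) = (\<Sum>k\<le>n. Bernstein n k p2 * h k)"
    using g_binomial[of n "t - w1"] assms w1_less_w2 by (simp add: h_def algebra_simps)
  moreover have "g (t - w2) = (\<Sum>k\<le>n. Bernstein n k p2 * h (Suc k))"
    using g_binomial[of n "t - w2"] assms w1_less_w2 by (simp add: h_def algebra_simps)
  ultimately have "g (t - w1) - g (t - w2) =
    (\<Sum>k\<le>N. Bernstein N k p2 * ((real N - real k) / (p1 * real N)) * h k
         - Bernstein N k p2 * (real k / (p2 * real N)) * h k)"
    unfolding sum_Bernstein_forward[OF p(2), of n h] sum_Bernstein_backward[OF p(1), of n h]
      sum_subtractf N_def p(3) by (simp only:)
  also have "\<dots> = (\<Sum>k\<le>N. Bernstein N k p2 * (real N * p2 - real k) * h k) / (p1 * p2 * real N)"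
    unfolding sum_divide_distrib
  proof (intro sum.cong refl)
    fix k
    have "(real N - real k) / (p1 * real N) - real k / (p2 * real N)
        = (p2 * (real N - real k) - p1 * real k) / (p1 * p2 * real N)"
      using p N by (simp add: divide_simps)
    also have "p2 * (real N - real k) - p1 * real k = real N * p2 - real k"
      unfolding p(3)[symmetric] by (simp add: algebra_simps)
    finally have *: "(real N - real k) / (p1 * real N) - real k / (p2 * real N)
      = (real N * p2 - real k) / (p1 * p2 * real N)" .
    have "Bernstein N k p2 * ((real N - real k) / (p1 * real N)) * h k
         - Bernstein N k p2 * (real k / (p2 * real N)) * h k
       = Bernstein N k p2 * ((real N - real k) / (p1 * real N) - real k / (p2 * real N)) * h k"
      by (simp only: algebra_simps)
    then show "Bernstein N k p2 * ((real N - real k) / (p1 * real N)) * h k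
         - Bernstein N k p2 * (real k / (p2 * real N)) * h k
       = Bernstein N k p2 * (real N * p2 - real k) * h k / (p1 * p2 * real N)"
      unfolding * by simp
  qed
  finally have "\<bar>g (t - w1) - g (t - w2)\<bar>
    = \<bar>\<Sum>k\<le>N. Bernstein N k p2 * (real N * p2 - real k) * h k\<bar> / (p1 * p2 * real N)"
    using p N by (simp add: abs_mult)
  also have "\<dots> \<le> (sqrt (real N * p2 * p1) * gmax) / (p1 * p2 * real N)"
  proof (intro divide_right_mono)
    have "\<bar>h k\<bar> \<le> gmax" if "k \<le> N" for k
    proof -
      have "real k * (w2 - w1) \<le> real N * (w2 - w1)"
        using that w1_less_w2 by (intro mult_right_mono) auto
      then have "- w2 \<le> t - real (Suc n) * w1 - real k * (w2 - w1)"
        using assms w2_pos by (simp add: N_def algebra_simps)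
      then show ?thesis using g_le_gmax g_pos by (simp add: h_def abs_of_pos)
    qed
    then have "\<bar>\<Sum>k\<le>N. Bernstein N k p2 * (real N * p2 - real k) * h k\<bar>
      \<le> (\<Sum>k\<le>N. Bernstein N k p2 * \<bar>real N * p2 - real k\<bar> * gmax)"
      using p p_less_1 Bernstein_nonneg[of p2 N]
      by (intro sum_abs[THEN order_trans] sum_mono) (auto simp: abs_mult intro!: mult_mono)
    also have "\<dots> \<le> sqrt (real N * p2 * p1) * gmax"
      using Bernstein_mean_abs_deviation[of p2 N] p p_less_1 N gmax_ge_1
      by (simp flip: sum_distrib_right)
    finally show "\<bar>\<Sum>k\<le>N. Bernstein N k p2 * (real N * p2 - real k) * h k\<bar> \<le> sqrt (real N * p2 * p1) * gmax" .
  qed (use p N in auto)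
  also have "\<dots> = gmax / sqrt (p1 * p2 * real N)"
  proof -
    have "0 < p1 * p2 * real N" using p N by simp
    then have "sqrt (p1 * p2 * real N) / (p1 * p2 * real N) = 1 / sqrt (p1 * p2 * real N)"
      by (simp only: sqrt_divide_self_eq less_imp_le inverse_eq_divide)
    moreover have "sqrt (real N * p2 * p1) = sqrt (p1 * p2 * real N)"
      by (simp only: mult_ac)
    ultimately have "gmax * (sqrt (real N * p2 * p1) / (p1 * p2 * real N))
        = gmax * (1 / sqrt (p1 * p2 * real N))"
      by (simp only:)
    then show ?thesis by (simp add: mult.commute)
  qed
  finally show ?thesis by (simp add: N_def)
qed

text \<open>
  The constant of the previous estimate after choosing \<open>n + 1 = \<lfloor>t / w2\<rfloor>\<close>, which is at least
  \<open>t / (2 * w2)\<close> for \<open>t \<ge> w2\<close>.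
\<close>
definition "step_const = gmax * sqrt (2 * w2 / (p1 * p2))"

lemma step_const_pos: "0 < step_const"
  using gmax_ge_1 w2_pos p_pos by (simp add: step_const_def)

lemma g_shift_diff:
  assumes "w2 \<le> t"
  shows "\<bar>g (t - w1) - g (t - w2)\<bar> \<le> step_const / sqrt t"
proof -
  define n where "n = nat \<lfloor>t / w2\<rfloor> - 1"
  have "1 \<le> t / w2" using assms w2_pos by simp
  then have fl: "1 \<le> \<lfloor>t / w2\<rfloor>" by simp
  then have Sn: "real (Suc n) = of_int \<lfloor>t / w2\<rfloor>" by (simp add: n_def)
  have "real (Suc n) \<le> t / w2" unfolding Sn by simp
  then have "real (Suc n) * w2 \<le> t" using w2_pos by (simp add: field_simps)
  then have n1: "real n * w2 \<le> t - w2" by (simp add: algebra_simps)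
  have "t / w2 < of_int \<lfloor>t / w2\<rfloor> + 1" by linarith
  then have "t / w2 \<le> 2 * real (Suc n)" using fl unfolding Sn by linarith
  then have n2: "t / (2 * w2) \<le> real (Suc n)" by simp
  have "0 < t" using assms w2_pos by simp
  have "\<bar>g (t - w1) - g (t - w2)\<bar> \<le> gmax / sqrt (p1 * p2 * real (Suc n))"
    by (rule g_shift_diff_binomial[OF n1])
  also have "\<dots> \<le> gmax / sqrt (p1 * p2 * (t / (2 * w2)))"
    using n2 p_pos \<open>0 < t\<close> w2_pos gmax_ge_1
    by (intro divide_left_mono real_sqrt_le_mono mult_left_mono mult_pos_pos) auto
  also have "\<dots> = step_const / sqrt t"
    unfolding step_const_def by (simp add: real_sqrt_divide real_sqrt_mult)
  finally show ?thesis .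
qed

text \<open>
  \<open>g t\<close> is a convex combination of the two values that have just been compared.
\<close>
lemma g_step:
  assumes "w2 \<le> t"
  shows "\<bar>g t - g (t - w1)\<bar> \<le> step_const / sqrt t" "\<bar>g t - g (t - w2)\<bar> \<le> step_const / sqrt t"
proof -
  define d where "d = g (t - w1) - g (t - w2)"
  have d: "\<bar>d\<bar> \<le> step_const / sqrt t" using g_shift_diff[OF assms] by (simp add: d_def)
  have p: "p1 = 1 - p2" using p_sum by simp
  have "g t = p1 * g (t - w1) + p2 * g (t - w2)" using assms w2_pos by (intro g_rec) simp
  then have "g t - g (t - w1) = - (p2 * d)" "g t - g (t - w2) = p1 * d"
    by (simp_all add: d_def p algebra_simps)
  moreover have "p2 * \<bar>d\<bar> \<le> \<bar>d\<bar>" "p1 * \<bar>d\<bar> \<le> \<bar>d\<bar>"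
    using p_pos p_less_1 by (simp_all add: mult_left_le_one_le)
  ultimately show "\<bar>g t - g (t - w1)\<bar> \<le> step_const / sqrt t"
    "\<bar>g t - g (t - w2)\<bar> \<le> step_const / sqrt t"
    using d p_pos by (simp_all add: abs_mult)
qed

lemma g_multistep:
  assumes v: "v = w1 \<or> v = w2" and a: "w2 \<le> a" "a \<le> b"
  shows "\<bar>g (b + real n * v) - g b\<bar> \<le> real n * (step_const / sqrt a)"
proof (induction n)
  case (Suc n)
  define t where "t = b + real (Suc n) * v"
  have v0: "0 < v" using v w1_pos w2_pos by auto
  then have "a \<le> t" using a by (simp add: t_def add_increasing2)
  then have "w2 \<le> t" "sqrt a \<le> sqrt t" "0 < sqrt a" "0 < sqrt t" using a w2_pos by auto
  then have "\<bar>g t - g (t - v)\<bar> \<le> step_const / sqrt t" using v g_step[of t] by auto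
  also have "\<dots> \<le> step_const / sqrt a"
    using \<open>sqrt a \<le> sqrt t\<close> \<open>0 < sqrt a\<close> \<open>0 < sqrt t\<close> step_const_pos by (intro divide_left_mono) auto
  finally have "\<bar>g t - g (t - v)\<bar> \<le> step_const / sqrt a" .
  moreover have "t - v = b + real n * v" by (simp add: t_def algebra_simps)
  ultimately have "\<bar>g t - g (b + real n * v)\<bar> + \<bar>g (b + real n * v) - g b\<bar>
      \<le> step_const / sqrt a + real n * (step_const / sqrt a)"
    using Suc.IH by simp
  also have "\<dots> = real (Suc n) * (step_const / sqrt a)" by (simp add: add_divide_distrib distrib_right)
  finally show ?case unfolding t_def by linarith
qed simp

text \<open>
  Walking from \<open>t\<close> to \<open>t - (i * w1 + j * w2)\<close> takes at most \<open>2 * R\<close> single steps. The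
  assumption \<open>4 * w2 * R \<le> t\<close> keeps the walk above \<open>t / 2\<close>, where a step costs at most
  \<open>step_const / sqrt (t / 2)\<close>.
\<close>
lemma g_lattice_shift:
  fixes i j :: int
  assumes t: "2 * w2 \<le> t" "4 * w2 * R \<le> t" and i: "\<bar>real_of_int i\<bar> \<le> R" and j: "0 \<le> j" "real_of_int j \<le> R"
  shows "\<bar>g (t - (i * w1 + j * w2)) - g t\<bar> \<le> 2 * R * (step_const / sqrt (t / 2))"
proof -
  define a where "a = t / 2"
  define b where "b = t - j * w2"
  define c where "c = b - i * w1"
  define E where "E = step_const / sqrt a"
  have a: "w2 \<le> a" using t by (simp add: a_def)
  have "0 < sqrt a" using a w2_pos by simp
  then have E: "0 \<le> E" using step_const_pos by (simp add: E_def)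
  have "j * w2 \<le> R * w2" using j w2_pos by (intro mult_right_mono) auto
  moreover have "0 \<le> R * w2" using i w2_pos by auto
  moreover have "4 * (R * w2) \<le> t" using t(2) by (simp add: mult_ac)
  ultimately have ab: "a \<le> b" "a \<le> b - R * w2" unfolding a_def b_def by linarith+
  have "\<bar>i\<bar> * w1 \<le> R * w2" using i w1_less_w2 w1_pos by (intro mult_mono) auto
  then have ac: "a \<le> c"
    using ab abs_mult[of "real_of_int i" w1] w1_pos abs_le_D1[of "i * w1" "R * w2"]
    by (auto simp: c_def)
  have "\<bar>g (b + real (nat j) * w2) - g b\<bar> \<le> real (nat j) * E"
    using g_multistep[of w2 a b "nat j"] a ab by (simp add: E_def)
  also have "\<dots> \<le> R * E" using j E by (intro mult_right_mono) auto
  finally have 1: "\<bar>g t - g b\<bar> \<le> R * E" using j by (simp add: b_def)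
  have "\<bar>g c - g b\<bar> \<le> real (nat \<bar>i\<bar>) * E"
  proof (cases "0 \<le> i")
    case True
    then show ?thesis
      using g_multistep[of w1 a c "nat i"] a ac by (simp add: E_def c_def)
  next
    case False
    then show ?thesis
      using g_multistep[of w1 a b "nat (- i)"] a ab by (simp add: E_def c_def)
  qed
  also have "\<dots> \<le> R * E" using i E by (intro mult_right_mono) auto
  finally have 2: "\<bar>g c - g b\<bar> \<le> R * E" .
  have "c = t - (i * w1 + j * w2)" by (simp add: c_def b_def)
  then show ?thesis using 1 2 by (simp add: E_def a_def)
qed


section \<open>Two-term renewal equations: limit and rate\<close>

lemma M_eq_g: "M t = exp (D * t) * g t"
  by (simp add: g_def flip: exp_add mult.assoc)

lemma g_integrable: "g integrable_on {a..b}"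
proof (cases "a \<le> b")
  case True
  have "(\<lambda>x. exp (- (D * x))) integrable_on {a..b}"
    by (intro integrable_continuous_real continuous_intros)
  from second_mean_value_theorem_full[OF this True, of M] obtain c where
    "((\<lambda>x. M x * exp (- (D * x))) has_integral
      (M a * integral {a..c} (\<lambda>x. exp (- (D * x))) + M b * integral {c..b} (\<lambda>x. exp (- (D * x))))) {a..b}"
    using monoD[OF M_mono] by blast
  then show ?thesis by (auto simp: integrable_on_def g_def[abs_def] mult.commute)
qed auto

lemma integral_g_neg:
  assumes "0 < v"
  shows "integral {-v..0} g = (exp (D * v) - 1) / D"
proof -
  have "((\<lambda>x. exp (- (D * x))) has_integral (- exp (- (D * 0)) / D - (- exp (- (D * - v)) / D))) {-v..0}"
    using assms D_pos
    by (intro fundamental_theorem_of_calculus)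
      (auto intro!: derivative_eq_intros simp flip: has_real_derivative_iff_has_vector_derivative)
  then have "(g has_integral (- exp (- (D * 0)) / D - (- exp (- (D * - v)) / D))) {-v..0}"
    by (rule has_integral_spike_finite[where S = "{0}", rotated 2]) (auto simp: g_def M_neg)
  then show ?thesis by (simp add: integral_unique diff_divide_distrib)
qed

text \<open>
  A conservation law identifies the limit. Integrating the renewal equation over \<open>[0, t]\<close> shows
  that the weighted sum of the two window integrals is independent of \<open>t\<close>; at \<open>t = 0\<close> it
  involves only the initial values, whose integral is \<open>(exp (D * v) - 1) / D\<close> for a window of
  length \<open>v\<close>.
\<close>
lemma renewal_invariant:
  assumes "0 \<le> t"
  shows "p1 * integral {t - w1..t} g + p2 * integral {t - w2..t} g = 1 / D"
proof -
  define G where "G = integral {0..t} g"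
  have window: "integral {t - v..t} g = (exp (D * v) - 1) / D + G - integral {0..t} (\<lambda>x. g (x - v))"
    if "0 < v" for v
  proof -
    have "integral {-v..0} g + G = integral {-v..t} g"
      using that assms by (simp add: G_def Henstock_Kurzweil_Integration.integral_combine g_integrable)
    moreover have "integral {-v..t - v} g + integral {t - v..t} g = integral {-v..t} g"
      using that assms by (intro Henstock_Kurzweil_Integration.integral_combine g_integrable) auto
    moreover have "integral {0..t} (\<lambda>x. g (x - v)) = integral {-v..t - v} g"
      using integral_shift_real_ivl[of "-v" "-v" "t - v" g] by simp
    ultimately show ?thesis using integral_g_neg[OF that] by linarith
  qed
  have shifted: "(\<lambda>x. g (x - v)) integrable_on {0..t}" for v
    using integrable_shift_real_ivl[OF g_integrable, of "-v" "-v" "t - v"] by simp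
  have "G = integral {0..t} (\<lambda>x. p1 * g (x - w1) + p2 * g (x - w2))"
    unfolding G_def by (intro integral_cong g_rec) auto
  also have "\<dots> = p1 * integral {0..t} (\<lambda>x. g (x - w1)) + p2 * integral {0..t} (\<lambda>x. g (x - w2))"
    using shifted by (simp add: integral_add integrable_on_mult_right)
  finally have G: "G = p1 * integral {0..t} (\<lambda>x. g (x - w1)) + p2 * integral {0..t} (\<lambda>x. g (x - w2))" .
  have "p1 * exp (D * w1) = 1" "p2 * exp (D * w2) = 1"
    by (simp_all add: p1_def p2_def flip: exp_add)
  then have K: "p1 * ((exp (D * w1) - 1) / D) = (1 - p1) / D" "p2 * ((exp (D * w2) - 1) / D) = (1 - p2) / D"
    by (simp_all add: algebra_simps)
  have "p1 * integral {t - w1..t} g + p2 * integral {t - w2..t} g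
     = p1 * ((exp (D * w1) - 1) / D) + p2 * ((exp (D * w2) - 1) / D) + (p1 + p2) * G
       - (p1 * integral {0..t} (\<lambda>x. g (x - w1)) + p2 * integral {0..t} (\<lambda>x. g (x - w2)))"
    unfolding window[OF w1_pos] window[OF w2_pos] by (simp only: algebra_simps)
  also have "\<dots> = (1 - p1) / D + (1 - p2) / D" unfolding K G[symmetric] p_sum by simp
  also have "\<dots> = (2 - (p1 + p2)) / D" by (simp add: diff_divide_distrib add_divide_distrib)
  finally show ?thesis unfolding p_sum by simp
qed

definition "mean = p1 * w1 + p2 * w2"

lemma mean_pos: "0 < mean"
  using p_pos w1_pos w2_pos by (simp add: mean_def add_pos_pos)

text \<open>
  If \<open>g\<close> is nearly constant on \<open>[t - w2, t]\<close>, each window integral is nearly the length of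
  the window times the value of \<open>g\<close> anywhere in it, and the conserved quantity pins down that
  value.
\<close>
lemma flat_imp_near_limit:
  assumes "0 \<le> t" and flat: "\<And>s. 0 \<le> s \<Longrightarrow> s \<le> w2 \<Longrightarrow> \<bar>g (t - s) - g t\<bar> \<le> \<eta>"
  shows "\<bar>p1 * w1 * g (t - w1) + p2 * w2 * g (t - w2) - 1 / D\<bar> \<le> 2 * mean * \<eta>"
proof -
  have \<eta>: "0 \<le> \<eta>" using flat[of 0] w2_pos by simp
  have win: "\<bar>v * g (t - v) - integral {t - v..t} g\<bar> \<le> 2 * v * \<eta>" if v: "0 < v" "v \<le> w2" for v
  proof -
    have "((\<lambda>x. g x - g t) has_integral (integral {t - v..t} g - v * g t)) {t - v..t}"
      using v has_integral_const_real[of "g t" "t - v" t]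
      by (intro has_integral_diff integrable_integral g_integrable) auto
    then have "norm (integral {t - v..t} g - v * g t) \<le> \<eta> * measure lborel {t - v..t}"
    proof (rule has_integral_bound_real[where S = "{}", rotated 2])
      fix x assume "x \<in> {t - v..t} - {}"
      then show "norm (g x - g t) \<le> \<eta>" using flat[of "t - x"] v by simp
    qed (use \<eta> in auto)
    then have "\<bar>integral {t - v..t} g - v * g t\<bar> \<le> v * \<eta>" using v by (simp add: mult.commute)
    moreover have "\<bar>v * g (t - v) - v * g t\<bar> \<le> v * \<eta>"
      using flat[of v] v by (simp add: abs_mult flip: right_diff_distrib)
    ultimately show ?thesis by linarith
  qed
  define e1 where "e1 = w1 * g (t - w1) - integral {t - w1..t} g"
  define e2 where "e2 = w2 * g (t - w2) - integral {t - w2..t} g"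
  have "\<bar>p1 * e1\<bar> \<le> p1 * (2 * w1 * \<eta>)" "\<bar>p2 * e2\<bar> \<le> p2 * (2 * w2 * \<eta>)"
    unfolding abs_mult e1_def e2_def using win[of w1] win[of w2] w1_pos w2_pos w1_less_w2 p_pos
    by (auto intro!: mult_mono)
  moreover have "p1 * w1 * g (t - w1) + p2 * w2 * g (t - w2) - 1 / D = p1 * e1 + p2 * e2"
    unfolding renewal_invariant[OF assms(1), symmetric] e1_def e2_def by (simp add: algebra_simps)
  moreover have "p1 * (2 * w1 * \<eta>) + p2 * (2 * w2 * \<eta>) = 2 * mean * \<eta>"
    by (simp add: mean_def algebra_simps)
  ultimately show ?thesis by linarith
qed

text \<open>
  A lattice point \<open>i * w1 + j * w2\<close> near \<open>[0, w2]\<close> with \<open>0 \<le> j < q\<close> has coefficients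
  bounded by \<open>coeff_const * q\<close>.
\<close>
definition "coeff_const = 2 * (w2 / w1) + 3"

definition "flat_const = 3 * D * w1 * exp (3 * D * w1) * gmax + 4 * coeff_const * step_const"

lemma coeff_const_pos: "0 < coeff_const"
  using w1_pos w2_pos by (simp add: coeff_const_def add_pos_pos)

lemma flat_const_pos: "0 < flat_const"
  using D_pos w1_pos gmax_ge_1 coeff_const_pos step_const_pos
  by (simp add: flat_const_def add_pos_pos)

text \<open>
  Every \<open>s\<close> in \<open>[0, w2]\<close> has lattice points \<open>i * w1 + j * w2\<close> within
  \<open>\<epsilon> = 3 * w1 / q\<close> on either side, with coefficients of order \<open>q\<close>. Moving from \<open>t\<close> by
  such a lattice point changes \<open>g\<close> by \<open>O(q / sqrt t)\<close>, and the remaining distance to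
  \<open>t - s\<close> is controlled by \<open>g_slow_decrease\<close>: the lattice point beyond \<open>s\<close> bounds
  \<open>g (t - s)\<close> from below, the one before \<open>s\<close> from above.
\<close>
lemma g_flat:
  fixes p q :: int
  assumes pq: "coprime p q" "1 \<le> q" "\<bar>w2 / w1 - p / q\<bar> \<le> 1 / (real_of_int q)\<^sup>2"
    and t: "2 * w2 \<le> t" "4 * w2 * coeff_const * q \<le> t" and s: "0 \<le> s" "s \<le> w2"
  shows "\<bar>g (t - s) - g t\<bar> \<le> flat_const * (1 / q + q / sqrt t)"
proof -
  define \<alpha> where "\<alpha> = w2 / w1"
  define \<epsilon> where "\<epsilon> = 3 * w1 / q"
  define R where "R = coeff_const * q"
  define E where "E = 2 * R * (step_const / sqrt (t / 2))"
  define F where "F = (exp (D * \<epsilon>) - 1) * gmax"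
  have c: "0 < q" "\<bar>\<alpha> - p / q\<bar> \<le> 1 / (real_of_int q)\<^sup>2" using pq by (simp_all add: \<alpha>_def)
  have \<alpha>: "0 < \<alpha>" using w1_pos w2_pos by (simp add: \<alpha>_def)
  have q: "1 \<le> real_of_int q" using pq by simp
  have \<epsilon>: "0 < \<epsilon>" "\<epsilon> \<le> 3 * w1" using q w1_pos by (simp_all add: \<epsilon>_def field_simps)
  have shift: "\<bar>g (t - (i * w1 + j * w2)) - g t\<bar> \<le> E"
    if ij: "0 \<le> j" "j < q" "-3 \<le> i + j * \<alpha>" "i + j * \<alpha> \<le> \<alpha> + 3" for i j :: int
    unfolding E_def
  proof (rule g_lattice_shift)
    have "j * \<alpha> \<le> q * \<alpha>" "0 \<le> j * \<alpha>" using ij \<alpha> by (auto intro!: mult_right_mono)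
    moreover have "\<alpha> \<le> q * \<alpha>" using q \<alpha> by simp
    moreover have "R = 2 * (q * \<alpha>) + 3 * q" by (simp add: R_def coeff_const_def \<alpha>_def algebra_simps)
    ultimately show "\<bar>real_of_int i\<bar> \<le> R" "real_of_int j \<le> R" using ij q by linarith+
  qed (use t ij in \<open>simp_all add: R_def\<close>)
  have scale: "s / w1 \<le> \<alpha>" "0 \<le> s / w1" using s w1_pos by (simp_all add: \<alpha>_def divide_right_mono)
  have q3: "3 / real_of_int q \<le> 3" using q by (simp add: field_simps)
  have "g t - g (t - s) \<le> E + F"
  proof -
    obtain i j :: int where ij: "0 \<le> j" "j < q" "s / w1 \<le> i + j * \<alpha>" "i + j * \<alpha> \<le> s / w1 + 3 / q"
      using lattice_covering[OF pq(1) c, of "s / w1"] by blast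
    define y where "y = i * w1 + j * w2"
    have y: "y = (i + j * \<alpha>) * w1" using w1_pos by (simp add: y_def \<alpha>_def field_simps)
    have "s / w1 * w1 \<le> y" "y \<le> (s / w1 + 3 / q) * w1"
      unfolding y using w1_pos by (intro mult_right_mono ij(3) ij(4); simp)+
    then have sy: "s \<le> y" "y \<le> s + \<epsilon>" using w1_pos by (simp_all add: \<epsilon>_def distrib_right)
    have "\<bar>g (t - y) - g t\<bar> \<le> E" unfolding y_def using ij scale q3 by (intro shift) auto
    moreover have "g (t - y) \<le> exp (D * (y - s)) * g (t - s)"
      using g_slow_decrease[of "t - y" "t - s"] sy by simp
    moreover have "exp (D * (y - s)) * g (t - s) \<le> exp (D * \<epsilon>) * g (t - s)"
      using sy D_pos g_pos[of "t - s"] by (intro mult_right_mono) auto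
    moreover have "(exp (D * \<epsilon>) - 1) * g (t - s) \<le> F"
      unfolding F_def using s t w2_pos \<epsilon> D_pos by (intro mult_left_mono g_le_gmax) auto
    moreover have "(exp (D * \<epsilon>) - 1) * g (t - s) = exp (D * \<epsilon>) * g (t - s) - g (t - s)"
      by (simp add: left_diff_distrib)
    ultimately show ?thesis by linarith
  qed
  moreover have "g (t - s) - g t \<le> E + F"
  proof -
    obtain i j :: int where ij: "0 \<le> j" "j < q" "s / w1 - 3 / q \<le> i + j * \<alpha>" "i + j * \<alpha> \<le> s / w1"
      using lattice_covering[OF pq(1) c, of "s / w1 - 3 / q", unfolded diff_add_cancel] by blast
    define y where "y = i * w1 + j * w2"
    have y: "y = (i + j * \<alpha>) * w1" using w1_pos by (simp add: y_def \<alpha>_def field_simps)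
    have "(s / w1 - 3 / q) * w1 \<le> y" "y \<le> s / w1 * w1"
      unfolding y using w1_pos by (intro mult_right_mono ij(3) ij(4); simp)+
    then have sy: "s - \<epsilon> \<le> y" "y \<le> s" using w1_pos by (simp_all add: \<epsilon>_def left_diff_distrib)
    have "\<bar>g (t - y) - g t\<bar> \<le> E" unfolding y_def using ij scale q3 by (intro shift) auto
    moreover have "g (t - s) \<le> exp (D * (s - y)) * g (t - y)"
      using g_slow_decrease[of "t - s" "t - y"] sy by simp
    moreover have "exp (D * (s - y)) * g (t - y) \<le> exp (D * \<epsilon>) * g (t - y)"
      using sy D_pos g_pos[of "t - y"] by (intro mult_right_mono) auto
    moreover have "(exp (D * \<epsilon>) - 1) * g (t - y) \<le> F"
      unfolding F_def using s sy t w2_pos \<epsilon> D_pos by (intro mult_left_mono g_le_gmax) auto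
    moreover have "(exp (D * \<epsilon>) - 1) * g (t - y) = exp (D * \<epsilon>) * g (t - y) - g (t - y)"
      by (simp add: left_diff_distrib)
    ultimately show ?thesis by linarith
  qed
  ultimately have "\<bar>g (t - s) - g t\<bar> \<le> E + F" by linarith
  also have "E \<le> 4 * coeff_const * step_const * (q / sqrt t)"
  proof -
    have "0 < sqrt t" using t w2_pos by simp
    have "sqrt 2 \<le> 2" using real_sqrt_le_mono[of 2 4] by simp
    then have "2 * R * step_const * sqrt 2 / sqrt t \<le> 2 * R * step_const * 2 / sqrt t"
      using \<open>0 < sqrt t\<close> coeff_const_pos step_const_pos q
      by (intro divide_right_mono mult_left_mono) (auto simp: R_def)
    then show ?thesis by (simp add: E_def R_def real_sqrt_divide mult_ac)
  qed
  also have "F \<le> 3 * D * w1 * exp (3 * D * w1) * gmax * (1 / q)"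
  proof -
    have "exp (D * \<epsilon>) * (1 - D * \<epsilon>) \<le> exp (D * \<epsilon>) * exp (- (D * \<epsilon>))"
      using exp_ge_add_one_self[of "- (D * \<epsilon>)"] by (intro mult_left_mono) auto
    then have "exp (D * \<epsilon>) - 1 \<le> D * \<epsilon> * exp (D * \<epsilon>)"
      by (simp add: algebra_simps flip: exp_add)
    also have "\<dots> \<le> D * \<epsilon> * exp (3 * D * w1)"
      using \<epsilon> D_pos by (intro mult_left_mono) auto
    finally have "F \<le> D * \<epsilon> * exp (3 * D * w1) * gmax"
      unfolding F_def using gmax_ge_1 by (intro mult_right_mono) auto
    then show ?thesis by (simp add: \<epsilon>_def mult_ac)
  qed
  finally have "\<bar>g (t - s) - g t\<bar> \<le> 4 * coeff_const * step_const * (q / sqrt t)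
    + 3 * D * w1 * exp (3 * D * w1) * gmax * (1 / q)" by simp
  also have "\<dots> \<le> flat_const * (q / sqrt t) + flat_const * (1 / q)"
    using D_pos w1_pos gmax_ge_1 coeff_const_pos step_const_pos q t w2_pos
    by (intro add_mono mult_right_mono) (auto simp: flat_const_def)
  finally show ?thesis by (simp add: algebra_simps)
qed

text \<open>
  Denominators up to \<open>K = t powr (1 / 4)\<close> are admitted in \<open>g_flat\<close>. Then \<open>q / sqrt t\<close> is at
  most \<open>t powr (- 1 / 4)\<close>, while the existence of a denominator of size at least
  \<open>K powr (1 / (l + 1))\<close>, up to a constant, makes \<open>1 / q\<close> of order
  \<open>t powr (- 1 / (4 * l + 4))\<close>. The constant \<open>w1 + w2\<close>, subtracted because leaves are
  counted instead of words, is negligible.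
\<close>
theorem renewal_rate:
  assumes irr: "w2 / w1 \<notin> \<rat>" and poly: "polynomially_approximable l (w2 / w1)"
  obtains B T0 where "1 \<le> T0" "0 < B" "\<And>t. T0 \<le> t \<Longrightarrow>
    \<bar>w1 * M (t - w1) + w2 * M (t - w2) - (w1 + w2) - exp (D * t) / D\<bar>
      \<le> B * (exp (D * t) * (1 / t) powr (1 / (4 * l + 4)))"
proof -
  obtain C where "0 < C" and C: "\<And>K::real. 1 \<le> K \<Longrightarrow> \<exists>p q::int. coprime p q \<and> 1 \<le> q \<and>
      real_of_int q \<le> K \<and> \<bar>w2 / w1 - p / q\<bar> \<le> 1 / (real_of_int q)\<^sup>2 \<and> K \<le> C * q powr (l + 1)"
    using good_denominator_below[OF irr poly] by metis
  have l: "0 \<le> l" using polynomially_approximable_exponent_nonneg[OF poly] .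
  define \<beta> where "\<beta> = 1 / (4 * l + 4)"
  have \<beta>: "0 < \<beta>" "\<beta> \<le> 1 / 4" using l by (simp_all add: \<beta>_def field_simps)
  define c where "c = 4 * w2 * coeff_const"
  have "0 < c" using w2_pos coeff_const_pos by (simp add: c_def)
  define A where "A = flat_const * (C powr (1 / (l + 1)) + 1)"
  define B where "B = 2 * mean * A + (w1 + w2) / D"
  define T0 where "T0 = max 1 (max (2 * w2) (c\<^sup>2))"
  have "0 < A" using flat_const_pos by (auto simp: A_def intro!: mult_pos_pos add_nonneg_pos)
  then have "0 < B" using mean_pos w1_pos w2_pos D_pos by (simp add: B_def add_pos_pos)
  have "\<bar>w1 * M (t - w1) + w2 * M (t - w2) - (w1 + w2) - exp (D * t) / D\<bar>
      \<le> B * (exp (D * t) * (1 / t) powr \<beta>)" if t: "T0 \<le> t" for t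
  proof -
    have t1: "1 \<le> t" "2 * w2 \<le> t" "c\<^sup>2 \<le> t" using t by (auto simp: T0_def)
    define \<tau> where "\<tau> = (1 / t) powr \<beta>"
    have \<tau>: "\<tau> = t powr (- \<beta>)" using t1 by (simp add: \<tau>_def powr_minus_divide powr_divide)
    have "1 \<le> t powr (1 / 4)" using t1 by (simp add: ge_one_powr_ge_zero)
    from C[OF this] obtain p q :: int where pq: "coprime p q" "1 \<le> q" "real_of_int q \<le> t powr (1 / 4)"
      "\<bar>w2 / w1 - p / q\<bar> \<le> 1 / (real_of_int q)\<^sup>2" "t powr (1 / 4) \<le> C * q powr (l + 1)" by blast
    have q: "1 \<le> real_of_int q" using pq by simp
    have "c \<le> t powr (1 / 2)" using t1(1,3) \<open>0 < c\<close> by (simp add: powr_half_sqrt real_le_rsqrt)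
    moreover have "real_of_int q \<le> t powr (1 / 2)"
      using pq(3) powr_mono[of "1/4" "1/2" t] t1 by linarith
    ultimately have "c * q \<le> t powr (1 / 2) * t powr (1 / 2)"
      using q by (intro mult_mono) auto
    also have "\<dots> = t" using t1 by (simp flip: powr_add)
    finally have cq: "4 * w2 * coeff_const * q \<le> t" by (simp add: c_def)
    have "q / sqrt t \<le> \<tau>"
    proof -
      have "q / sqrt t \<le> t powr (1 / 4) / t powr (1 / 2)"
        using pq(3) t1 by (simp add: powr_half_sqrt divide_right_mono)
      also have "\<dots> = t powr (- (1 / 4))" by (simp flip: powr_diff)
      also have "\<dots> \<le> \<tau>" unfolding \<tau> using \<beta> t1 by (intro powr_mono) auto
      finally show ?thesis .
    qed
    moreover have "1 / q \<le> C powr (1 / (l + 1)) * \<tau>"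
    proof -
      have "(t powr (1 / 4)) powr (1 / (l + 1)) \<le> (C * q powr (l + 1)) powr (1 / (l + 1))"
        using pq(5) l by (intro powr_mono2) auto
      also have "\<dots> = C powr (1 / (l + 1)) * q"
        using \<open>0 < C\<close> q l by (simp add: powr_mult powr_powr)
      also have "(t powr (1 / 4)) powr (1 / (l + 1)) = t powr \<beta>"
        by (simp add: powr_powr \<beta>_def algebra_simps)
      finally have "t powr \<beta> * \<tau> \<le> C powr (1 / (l + 1)) * q * \<tau>"
        by (intro mult_right_mono) (auto simp: \<tau>)
      moreover have "t powr \<beta> * \<tau> = 1" using t1 by (simp add: \<tau> flip: powr_add)
      ultimately show ?thesis using q by (simp add: field_simps)
    qed
    ultimately have "1 / q + q / sqrt t \<le> (C powr (1 / (l + 1)) + 1) * \<tau>"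
      by (simp add: algebra_simps)
    then have "flat_const * (1 / q + q / sqrt t) \<le> flat_const * ((C powr (1 / (l + 1)) + 1) * \<tau>)"
      using flat_const_pos by (intro mult_left_mono) auto
    also have "\<dots> = A * \<tau>" by (simp add: A_def)
    finally have flat: "\<bar>g (t - s) - g t\<bar> \<le> A * \<tau>" if "0 \<le> s" "s \<le> w2" for s
      using g_flat[OF pq(1,2,4) t1(2) cq that] by linarith
    define e where "e = p1 * w1 * g (t - w1) + p2 * w2 * g (t - w2) - 1 / D"
    have e: "\<bar>e\<bar> \<le> 2 * mean * (A * \<tau>)"
      unfolding e_def using t1 by (intro flat_imp_near_limit flat) auto
    have "w1 * M (t - w1) + w2 * M (t - w2) - exp (D * t) / D = exp (D * t) * e"
      by (simp add: M_eq_g e_def p1_def p2_def right_diff_distrib exp_diff exp_minus field_simps)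
    then have "\<bar>w1 * M (t - w1) + w2 * M (t - w2) - (w1 + w2) - exp (D * t) / D\<bar>
      \<le> \<bar>exp (D * t) * e\<bar> + (w1 + w2)" using w1_pos w2_pos by linarith
    also have "\<bar>exp (D * t) * e\<bar> \<le> exp (D * t) * (2 * mean * (A * \<tau>))"
      unfolding abs_mult using e by simp
    \<comment> \<open>Since \<open>\<beta> \<le> 1\<close>, the right-hand side is at least
      \<open>(w1 + w2) / D * (D * t * t powr (-1)) = w1 + w2\<close>.\<close>
    also have "w1 + w2 \<le> (w1 + w2) / D * (exp (D * t) * \<tau>)"
    proof -
      have "D * t * t powr (- 1) \<le> exp (D * t) * \<tau>"
        unfolding \<tau>
      proof (intro mult_mono powr_mono)
        show "D * t \<le> exp (D * t)" using exp_ge_add_one_self[of "D * t"] by linarith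
      qed (use \<beta> t1 D_pos in auto)
      then have "D \<le> exp (D * t) * \<tau>" using t1 by (simp add: powr_minus_divide)
      then have "(w1 + w2) / D * D \<le> (w1 + w2) / D * (exp (D * t) * \<tau>)"
        using w1_pos w2_pos D_pos by (intro mult_left_mono) auto
      then show ?thesis using D_pos by simp
    qed
    finally show ?thesis by (simp add: B_def \<tau>_def algebra_simps)
  qed
  then show thesis using that[of T0 B] \<open>0 < B\<close> by (simp add: \<beta>_def T0_def)
qed

end


section \<open>The counting function\<close>

text \<open>
  The left-hand side of the equation decreases strictly from the value \<open>2\<close> at \<open>0\<close>, and is at
  most \<open>1\<close> at \<open>ln 2 / w 1\<close>.
\<close>
lemma bernoulli_dim_exists:
  assumes "0 < w 1" "w 1 < w 2"
  shows "0 < bernoulli_dim w" "exp (- (bernoulli_dim w * w 1)) + exp (- (bernoulli_dim w * w 2)) = 1"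
proof -
  define f where "f s = exp (- w 1 * s) + exp (- w 2 * s)" for s
  have dec: "f t < f s" if "s < t" for s t
    unfolding f_def using that assms by (intro add_strict_mono) auto
  have f0: "f 0 = 2" by (simp add: f_def)
  have "f (ln 2 / w 1) \<le> 1"
  proof -
    have "exp (- w 1 * (ln 2 / w 1)) = 1 / 2" using assms by (simp add: exp_minus)
    moreover have "exp (- w 2 * (ln 2 / w 1)) \<le> exp (- w 1 * (ln 2 / w 1))"
      using assms by (intro iffD2[OF exp_le_cancel_iff] mult_right_mono) auto
    ultimately show ?thesis by (simp only: f_def)
  qed
  moreover have "continuous_on {0..ln 2 / w 1} f" unfolding f_def by (intro continuous_intros)
  ultimately obtain s where s: "0 \<le> s" "f s = 1"
    using IVT2'[of f "ln 2 / w 1" 1 0] f0 assms by auto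
  have "\<exists>!s. f s = 1" using s dec by (metis linorder_neqE_linordered_idom order_less_irrefl)
  then have "f (bernoulli_dim w) = 1"
    unfolding bernoulli_dim_def f_def[symmetric] by (rule theI')
  then show "exp (- (bernoulli_dim w * w 1)) + exp (- (bernoulli_dim w * w 2)) = 1"
    by (simp add: f_def mult.commute)
  show "0 < bernoulli_dim w"
    using \<open>f (bernoulli_dim w) = 1\<close> dec[of "bernoulli_dim w" 0] f0
    by (metis linorder_neqE_linordered_idom not_less_iff_gr_or_eq numeral_One numeral_eq_iff one_less_numeral_iff order_less_trans semiring_norm(76) semiring_norm(83))
qed

text \<open>
  The factor \<open>ln (ln x)\<close> only weakens the bound: it is at least \<open>1\<close> for
  \<open>x \<ge> exp (exp 1)\<close>.
\<close>
lemma psi_asymptotic: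
  assumes w: "0 < w 1" "w 1 < w 2" and irr: "w 2 / w 1 \<notin> \<rat>"
    and poly: "polynomially_approximable l (w 2 / w 1)"
  defines "D \<equiv> bernoulli_dim w"
  shows "(\<lambda>x. psi (bernoulli_weight w) x - x powr D / D)
     \<in> O(\<lambda>x. x powr D * (ln (ln x) / ln x) powr (1 / (4 * l + 4)))"
proof -
  have w2: "0 < w 2" using w by simp
  interpret two_term_renewal "w 1" "w 2" D "leaf_count w"
    using w w2 bernoulli_dim_exists[OF w] leaf_count_mono[OF w(1) w2] leaf_count_rec[OF w(1) w2]
      words_upto_neg[OF w(1) w2]
    by unfold_locales (auto simp: D_def leaf_count_def)
  obtain B T0 where B: "1 \<le> T0" "0 < B" "\<And>t. T0 \<le> t \<Longrightarrow>
    \<bar>w 1 * leaf_count w (t - w 1) + w 2 * leaf_count w (t - w 2) - (w 1 + w 2) - exp (D * t) / D\<bar>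
      \<le> B * (exp (D * t) * (1 / t) powr (1 / (4 * l + 4)))"
    using renewal_rate[OF irr poly] by metis
  have l: "0 \<le> l" using polynomially_approximable_exponent_nonneg[OF poly] .
  show ?thesis
  proof (rule landau_o.bigI[OF B(2)])
    show "eventually (\<lambda>x. norm (psi (bernoulli_weight w) x - x powr D / D)
      \<le> B * norm (x powr D * (ln (ln x) / ln x) powr (1 / (4 * l + 4)))) at_top"
      using eventually_ge_at_top[of "exp T0"] eventually_ge_at_top[of "exp (exp 1)"]
    proof eventually_elim
      case (elim x)
      have "0 < x" using elim(1) less_le_trans[OF exp_gt_zero] by blast
      define t where "t = ln x"
      have t: "T0 \<le> t" "exp 1 \<le> t"
        unfolding t_def using elim \<open>0 < x\<close> by (simp_all add: ln_ge_iff)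
      have "0 < t" using t B(1) by simp
      then have "1 \<le> ln t" using t by (simp add: ln_ge_iff)
      have x: "exp (D * t) = x powr D" using \<open>0 < x\<close> by (simp add: t_def powr_def)
      have "\<bar>psi (bernoulli_weight w) x - x powr D / D\<bar>
        \<le> B * (x powr D * (1 / t) powr (1 / (4 * l + 4)))"
        using B(3)[OF t(1)] unfolding psi_eq_leaf_count[where w = w, OF w(1) w2] t_def[symmetric] x .
      also have "\<dots> \<le> B * (x powr D * (ln t / t) powr (1 / (4 * l + 4)))"
        using B(2) \<open>1 \<le> ln t\<close> \<open>0 < t\<close> l
        by (intro mult_left_mono powr_mono2 divide_right_mono) auto
      finally show ?case by (simp add: t_def)
    qed
  qed
qed

theorem theorem6p7:
  fixes w :: "nat \<Rightarrow> real" and D :: real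
  assumes "0 < w 1" and "w 1 < w 2"
    and "w 2 / w 1 \<notin> \<rat>"
    and "D = bernoulli_dim w"
  shows "(cf_bounded (w 2 / w 1) \<longrightarrow>
            (\<lambda>x. psi (bernoulli_weight w) x - x powr D / D)
              \<in> O(\<lambda>x. x powr D * (ln (ln x) / ln x) powr (1 / 4))) \<and>
         (\<forall>l::real. polynomially_approximable l (w 2 / w 1) \<longrightarrow>
            (\<lambda>x. psi (bernoulli_weight w) x - x powr D / D)
              \<in> O(\<lambda>x. x powr D * (ln (ln x) / ln x) powr (1 / (4 * l + 4))))"
proof (intro conjI impI allI)
  assume "cf_bounded (w 2 / w 1)"
  from psi_asymptotic[OF assms(1-3) cf_bounded_imp_polynomially_approximable[OF this]]
  show "(\<lambda>x. psi (bernoulli_weight w) x - x powr D / D)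
     \<in> O(\<lambda>x. x powr D * (ln (ln x) / ln x) powr (1 / 4))"
    by (simp add: assms(4))
next
  fix l assume "polynomially_approximable l (w 2 / w 1)"
  from psi_asymptotic[OF assms(1-3) this]
  show "(\<lambda>x. psi (bernoulli_weight w) x - x powr D / D)
     \<in> O(\<lambda>x. x powr D * (ln (ln x) / ln x) powr (1 / (4 * l + 4)))"
    by (simp only: assms(4))
qed

end
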